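(* Let $m\ge1$ and $0\le n_0\le m$ be integers, $\rho>0$, and $\mathrm{Re}(\theta)>0$. Let $N(t)$ be the Erlang A process with abandonment rate $\eta>0$ and $N(0)=n_0$, let $p_n(t)=\mathrm{Prob}[N(t)=n\mid N(0)=n_0]$ and $\widehat P_n(\theta)=\int_0^\infty e^{-\theta t}p_n(t)\,dt$. Then, as $\eta\to\infty$ (with the other parameters fixed), $\widehat P_n(\theta)$ approaches the limit $$\frac{n_0!\,\Gamma(\theta)e^{-\rho}}{\rho^{n_0+\theta}}F_{n_0}(\theta)\left[G_n(\theta)+\omega F_n(\theta)\right]\quad\text{for } n_0\le n\le m,$$ $$\frac{n_0!\,\Gamma(\theta)e^{-\rho}}{\rho^{n_0+\theta}}F_{n}(\theta)\left[G_{n_0}(\theta)+\omega F_{n_0}(\theta)\right]\quad\text{for } 0\le n\le n_0,$$ where $$\omega=\frac{(m+1)G_{m+1}(\theta)-\rho G_m(\theta)}{\rho F_m(\theta)-(m+1)F_{m+1}(\theta)}.$$ In particular, in this limit the blocking probability $p_m(t)$ has the Laplace transform $$\widehat P_m(\theta)=\frac{n_0!}{m!}\rho^{m-n_0}\frac{F_{n_0}(\theta)}{(m+1)F_{m+1}(\theta)-\rho F_m(\theta)}.$$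
   Context: Erlang A model ($M/M/m+M$ queue) with service rate $\mu=1$: $N(t)$ is the birth–death process on $\{0,1,2,\dots\}$ with birth rate $\rho$ in every state, and death rate $n$ in state $n$ for $0\le n\le m$ and $m+(n-m)\eta$ in state $n$ for $n\ge m$. (The limit $\eta\to\infty$ corresponds to the $M/M/m/m$ loss model.) Special functions (for integer $n$): $$F_n(\theta)=\frac{1}{2\pi i}\int_{C_0}\frac{e^{\rho z}}{z^{n+1}(1-z)^\theta}\,dz,\qquad G_n(\theta)=\frac{1}{2\pi i}\int_{C_1}\frac{e^{\rho z}}{z^{n+1}(z-1)^\theta}\,dz,$$ where $C_0$ is a small counterclockwise circle about $0$ inside $|z|<1$; $C_1$ goes from $-\infty-i\varepsilon$ to $-\infty+i\varepsilon$ ($\varepsilon>0$), encircling $z=1$ counterclockwise and avoiding $\{\mathrm{Im}(z)=0,\mathrm{Re}(z)\le1\}$. Branches: $(1-z)^\theta=|1-z|^\theta e^{i\theta\arg(1-z)}$ with $|\arg(1-z)|<\pi$, and $(z-1)^\theta=|z-1|^\theta e^{i\theta\arg(z-1)}$ with $|\arg(z-1)|<\pi$. $\Gamma$ is the Gamma function. *)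

theory Defs
  imports "HOL-Probability.Probability" "HOL-Complex_Analysis.Complex_Analysis"
begin

definition transition_function :: "(nat \<Rightarrow> nat \<Rightarrow> real \<Rightarrow> real) \<Rightarrow> bool" where
  "transition_function P \<longleftrightarrow>
     (\<forall>i j t. 0 \<le> t \<longrightarrow> 0 \<le> P i j t) \<and>
     (\<forall>i t. 0 \<le> t \<longrightarrow> (\<lambda>j. P i j t) sums 1) \<and>
     (\<forall>i j. P i j 0 = (if i = j then 1 else 0)) \<and>
     (\<forall>i j s t. 0 \<le> s \<longrightarrow> 0 \<le> t \<longrightarrow> (\<lambda>k. P i k s * P k j t) sums P i j (s + t))"

text \<open>Infinitesimal generator; \<open>death 0\<close> is meant to be \<open>0\<close>.\<close>

definition birth_death_rate :: "(nat \<Rightarrow> real) \<Rightarrow> (nat \<Rightarrow> real) \<Rightarrow> nat \<Rightarrow> nat \<Rightarrow> real" where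
  "birth_death_rate birth death i j =
     (if j = i + 1 then birth i
      else if i = j + 1 then death i
      else if i = j then - (birth i + death i)
      else 0)"

definition markov_process ::
    "'a measure \<Rightarrow> (real \<Rightarrow> 'a \<Rightarrow> nat) \<Rightarrow> (nat \<Rightarrow> nat \<Rightarrow> real \<Rightarrow> real) \<Rightarrow> bool" where
  "markov_process M X P \<longleftrightarrow>
     prob_space M \<and>
     (\<forall>t\<ge>0. X t \<in> measurable M (count_space UNIV)) \<and>
     (\<forall>(k::nat) (t :: nat \<Rightarrow> real) (i :: nat \<Rightarrow> nat).
        0 \<le> t 0 \<longrightarrow> (\<forall>l\<le>k. t l < t (Suc l)) \<longrightarrow>
        0 < \<P>(x in M. \<forall>l\<le>k. X (t l) x = i l) \<longrightarrow>
        \<P>(x in M. X (t (Suc k)) x = i (Suc k) \<bar> \<forall>l\<le>k. X (t l) x = i l)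
          = P (i k) (i (Suc k)) (t (Suc k) - t k))"

definition birth_death_process ::
    "(nat \<Rightarrow> real) \<Rightarrow> (nat \<Rightarrow> real) \<Rightarrow> 'a measure \<Rightarrow> (real \<Rightarrow> 'a \<Rightarrow> nat) \<Rightarrow> bool" where
  "birth_death_process birth death M X \<longleftrightarrow>
     (\<exists>P. transition_function P \<and>
          (\<forall>i j. (P i j has_real_derivative birth_death_rate birth death i j) (at_right 0)) \<and>
          markov_process M X P)"

definition erlang_A_death :: "nat \<Rightarrow> real \<Rightarrow> nat \<Rightarrow> real" where
  "erlang_A_death m \<eta> n = (if n \<le> m then real n else real m + (real n - real m) * \<eta>)"

definition erlang_A_process ::
    "nat \<Rightarrow> real \<Rightarrow> real \<Rightarrow> nat \<Rightarrow> 'a measure \<Rightarrow> (real \<Rightarrow> 'a \<Rightarrow> nat) \<Rightarrow> bool" where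
  "erlang_A_process m \<rho> \<eta> n\<^sub>0 M X \<longleftrightarrow>
     birth_death_process (\<lambda>_. \<rho>) (erlang_A_death m \<eta>) M X \<and>
     (AE x in M. X 0 x = n\<^sub>0)"

definition laplace_transform :: "(real \<Rightarrow> real) \<Rightarrow> complex \<Rightarrow> complex" where
  "laplace_transform p \<theta> = (LINT t:{0..}|lborel. exp (- \<theta> * of_real t) * of_real (p t))"

text \<open>
  \<open>powr\<close> on complex numbers is the principal branch, cut along the nonpositive reals, so
  that \<open>(1 - z) powr \<theta>\<close> and \<open>(z - 1) powr \<theta>\<close> have arguments in \<open>(-\<pi>, \<pi>)\<close> off the cuts
  \<open>[1, \<infinity>)\<close> and \<open>(-\<infinity>, 1]\<close>.  The radius \<open>r\<close> is meant to satisfy \<open>0 < r < 1\<close>.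
\<close>

definition erlang_F :: "real \<Rightarrow> real \<Rightarrow> int \<Rightarrow> complex \<Rightarrow> complex" where
  "erlang_F r \<rho> n \<theta> =
     1 / (2 * of_real pi * \<i>) *
     contour_integral (circlepath 0 r)
       (\<lambda>z. exp (of_real \<rho> * z) / (z powi (n + 1) * (1 - z) powr \<theta>))"

text \<open>
  The contour from \<open>-\<infinity> - i\<epsilon>\<close> to \<open>-\<infinity> + i\<epsilon>\<close> around \<open>1\<close>, cut off at real part \<open>-R\<close>: two
  horizontal rays joined by the right half of the circle of radius \<open>\<epsilon>\<close> about \<open>1\<close>.
\<close>

definition hankel_path :: "real \<Rightarrow> real \<Rightarrow> real \<Rightarrow> complex" where
  "hankel_path \<epsilon> R =
     linepath (Complex (- R) (- \<epsilon>)) (Complex 1 (- \<epsilon>)) +++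
     part_circlepath 1 \<epsilon> (- (pi / 2)) (pi / 2) +++
     linepath (Complex 1 \<epsilon>) (Complex (- R) \<epsilon>)"

definition erlang_G :: "real \<Rightarrow> real \<Rightarrow> int \<Rightarrow> complex \<Rightarrow> complex" where
  "erlang_G \<epsilon> \<rho> n \<theta> =
     1 / (2 * of_real pi * \<i>) *
     Lim at_top (\<lambda>R. contour_integral (hankel_path \<epsilon> R)
       (\<lambda>z. exp (of_real \<rho> * z) / (z powi (n + 1) * (z - 1) powr \<theta>)))"

definition erlang_omega :: "real \<Rightarrow> real \<Rightarrow> real \<Rightarrow> nat \<Rightarrow> complex \<Rightarrow> complex" where
  "erlang_omega r \<epsilon> \<rho> m \<theta> =
     (of_nat (m + 1) * erlang_G \<epsilon> \<rho> (int m + 1) \<theta> - of_real \<rho> * erlang_G \<epsilon> \<rho> (int m) \<theta>) /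
     (of_real \<rho> * erlang_F r \<rho> (int m) \<theta> - of_nat (m + 1) * erlang_F r \<rho> (int m + 1) \<theta>)"

end

theory Submission
  imports Defs "HOL-Real_Asymp.Real_Asymp"
begin

text \<open>
  For a fixed target state \<open>j\<close> the Laplace transforms \<open>L i\<close> of the transition probabilities from \<open>i\<close>
  to \<open>j\<close> satisfy the backward resolvent equations and are bounded by \<open>1 / Re \<theta>\<close> uniformly in \<open>\<eta>\<close>.  The
  equation at state \<open>m + 1\<close>, whose death rate is \<open>m + \<eta>\<close>, therefore forces \<open>L (m + 1) - L m \<longrightarrow> 0\<close>: in the
  limit the system closes up on \<open>{0..m}\<close> with reflection at \<open>m\<close>.  Both \<open>i! / \<rho>^i * F\<^sub>i\<close> and
  \<open>i! / \<rho>^i * G\<^sub>i\<close> solve the homogeneous equations (integrate a total derivative along the contour), the first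
  one regularly at \<open>0\<close>, so the limit is the discrete Green's function built from them.  Their
  Casoratian reduces to the index \<open>-1\<close>, where \<open>F\<close> vanishes and \<open>G\<close> is Hankel's integral for
  \<open>1 / Gamma \<theta>\<close>.  Strict diagonal dominance, from \<open>Re \<theta> > 0\<close>, keeps the denominator of \<open>\<omega>\<close> away from \<open>0\<close>.
\<close>

section \<open>Three-term recurrences with reflection\<close>

text \<open>Backward equations suit the limit because the large rate then multiplies a difference of
  bounded transforms; in the forward equations it would multiply a single transform that vanishes,
  and the limit of the product would have to be found. They also need little regularity: each state
  has finitely many neighbours with rates summing to zero, so the derivatives at time 0 alone show
  that the mass lost to all other states is o(h), uniformly in the target and the elapsed time. The
  price is a change of unknown. \<open>F\<close> and \<open>G\<close> satisfy the forward
  recurrence; the factor \<open>i! / \<rho>^i\<close>, the inverse of the reversing measure, turns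
  it into the backward one, and the measure of the target state returns through the constant
  \<open>\<kappa>\<close>. Hankel's integral is wanted for \<open>Re \<theta> > 0\<close>, where the
  power can be singular at 1. It is evaluated where the contour collapses onto the cut without
  divergence, namely for \<open>Re \<theta> < 0\<close>, and carried over by a recurrence in
  \<theta>. That recurrence divides by \<theta>, so positive integers need a separate starting
  value.\<close>

lemma norm_increasing_recurrence:
  fixes u :: "nat \<Rightarrow> complex" and \<rho> :: real and \<theta> :: complex
  assumes "\<rho> > 0" "Re \<theta> > 0" "u 0 \<noteq> 0"
    and rec: "\<And>i. of_real \<rho> * u (Suc i) = (\<theta> + of_real \<rho> + of_nat i) * u i - of_nat i * u (i - 1)"
  shows "norm (u i) < norm (u (Suc i))"
proof -
  have ge: "norm (\<theta> + of_real \<rho> + of_nat i) > \<rho> + real i" for i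
    using complex_Re_le_cmod[of "\<theta> + of_real \<rho> + of_nat i"] assms(2) by simp
  \<comment> \<open>Triangle inequality for \<open>(\<theta> + \<rho> + i) * u i = \<rho> * u (Suc
    i) + i * u (i - 1)\<close>; strictness is the gain from \<open>Re \<theta> > 0\<close>. At
    \<open>i = 0\<close> the predecessor is 0 itself and its coefficient vanishes, so the second
    premise is trivial and the induction starts.\<close>
  have step: "norm (u i) < norm (u (Suc i))" if "u i \<noteq> 0" "norm (u (i - 1)) \<le> norm (u i)" for i
  proof -
    have "(\<rho> + real i) * norm (u i) < norm (\<theta> + of_real \<rho> + of_nat i) * norm (u i)"
      using ge[of i] that(1) by simp
    also have "\<dots> = norm (of_real \<rho> * u (Suc i) + of_nat i * u (i - 1))"
      by (simp add: rec norm_mult)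
    also have "\<dots> \<le> \<rho> * norm (u (Suc i)) + real i * norm (u (i - 1))"
      using assms(1) norm_triangle_ineq[of "of_real \<rho> * u (Suc i)" "of_nat i * u (i - 1)"]
      by (simp add: norm_mult)
    also have "\<dots> \<le> \<rho> * norm (u (Suc i)) + real i * norm (u i)"
      using that(2) by (simp add: mult_left_mono)
    finally show ?thesis using assms(1) by (simp add: algebra_simps)
  qed
  show ?thesis
  proof (induction i)
    case 0
    then show ?case using step[of 0] assms(3) by simp
  next
    case (Suc i)
    then show ?case using step[of "Suc i"] by fastforce
  qed
qed

text \<open>Variation of parameters. As a function of \<open>i\<close>, the combination
  \<open>u i * v j - u j * v i\<close> solves the homogeneous recurrence and vanishes at
  \<open>j\<close>; the normalisation of \<open>\<kappa>\<close> makes its value at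
  \<open>Suc j\<close> absorb the unit source in the equation at \<open>j\<close>. Only recurrences
  at indices above \<open>j\<close> are used for \<open>v\<close>, so its failure at 0 does no
  harm.\<close>

lemma green_representation:
  fixes u v l :: "nat \<Rightarrow> complex" and \<rho> :: real and \<theta> \<kappa> :: complex
  assumes rho: "\<rho> \<noteq> 0" and "u 0 = 1" and "j \<le> m"
    and u_rec: "\<And>i. of_real \<rho> * u (Suc i) = (\<theta> + of_real \<rho> + of_nat i) * u i - of_nat i * u (i - 1)"
    and v_rec: "\<And>i. i > 0 \<Longrightarrow>
      of_real \<rho> * v (Suc i) = (\<theta> + of_real \<rho> + of_nat i) * v i - of_nat i * v (i - 1)"
    and \<kappa>: "\<kappa> * (u (Suc j) * v j - u j * v (Suc j)) = 1 / of_real \<rho>"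
    and l_rec: "\<And>i. i \<le> m \<Longrightarrow> of_real \<rho> * l (Suc i) =
      (\<theta> + of_real \<rho> + of_nat i) * l i - of_nat i * l (i - 1) - (if i = j then 1 else 0)"
  shows "i \<le> j \<Longrightarrow> l i = l 0 * u i"
    and "j \<le> i \<Longrightarrow> i \<le> Suc m \<Longrightarrow> l i = l 0 * u i - \<kappa> * (u i * v j - u j * v i)"
proof -
  have r0: "complex_of_real \<rho> \<noteq> 0" using rho by simp
  have low: "l i = l 0 * u i" if "i \<le> j" for i
    using that
  proof (induction i rule: less_induct)
    case (less i)
    show ?case
    proof (cases i)
      case 0
      then show ?thesis using \<open>u 0 = 1\<close> by simp
    next
      case (Suc k)
      have IH: "l k = l 0 * u k" "l (k - 1) = l 0 * u (k - 1)" 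
        by (rule less.IH; use less.prems Suc in simp)+
      have "of_real \<rho> * l (Suc k) = (\<theta> + of_real \<rho> + of_nat k) * l k - of_nat k * l (k - 1)"
        using l_rec[of k] less.prems \<open>j \<le> m\<close> Suc by simp
      also have "\<dots> = l 0 * (of_real \<rho> * u (Suc k))"
        unfolding u_rec IH by (simp add: algebra_simps)
      finally have "of_real \<rho> * l i = of_real \<rho> * (l 0 * u i)"
        using Suc by (simp add: mult_ac)
      then show ?thesis using r0 by simp
    qed
  qed
  show "i \<le> j \<Longrightarrow> l i = l 0 * u i" by (rule low)
  define w where "w i = l 0 * u i - \<kappa> * (u i * v j - u j * v i)" for i
  have w_Suc: "of_real \<rho> * w (Suc i) = (\<theta> + of_real \<rho> + of_nat i) * w i - of_nat i * w (i - 1)"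
    if "i > 0" for i
  proof -
    have "of_real \<rho> * w (Suc i) = l 0 * (of_real \<rho> * u (Suc i))
       - \<kappa> * ((of_real \<rho> * u (Suc i)) * v j - u j * (of_real \<rho> * v (Suc i)))"
      by (simp add: w_def algebra_simps)
    also have "\<dots> = (\<theta> + of_real \<rho> + of_nat i) * w i - of_nat i * w (i - 1)"
      unfolding u_rec v_rec[OF that] w_def by (simp add: algebra_simps)
    finally show ?thesis .
  qed
  \<comment> \<open>Two consecutive values are carried along because the recurrence has order
    two.\<close>
  have high: "l i = w i \<and> l (Suc i) = w (Suc i)" if "j \<le> i" "i \<le> m" for i
    using that
  proof (induction i rule: dec_induct)
    case base
    have "of_real \<rho> * l (Suc j) = (\<theta> + of_real \<rho> + of_nat j) * l j - of_nat j * l (j - 1) - 1"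
      using l_rec[of j] \<open>j \<le> m\<close> by simp
    also have "\<dots> = l 0 * (of_real \<rho> * u (Suc j)) - 1"
      unfolding u_rec low[of j, OF order_refl] low[of "j - 1", OF diff_le_self] by (simp add: algebra_simps)
    also have "\<dots> = of_real \<rho> * w (Suc j)"
      using r0 \<kappa> by (simp add: w_def algebra_simps)
    finally show ?case using r0 low[of j] by (simp add: w_def)
  next
    case (step i)
    have "of_real \<rho> * l (Suc (Suc i)) = of_real \<rho> * w (Suc (Suc i))"
      using l_rec[of "Suc i"] w_Suc[of "Suc i"] step by simp
    then show ?case using r0 step by simp
  qed
  show "l i = l 0 * u i - \<kappa> * (u i * v j - u j * v i)" if "j \<le> i" "i \<le> Suc m"
  proof -
    have "l i = w i"
    proof (cases "i \<le> m")
      case True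
      then show ?thesis using high[of i] that(1) by simp
    next
      case False
      then have "i = Suc m" using that(2) by simp
      then show ?thesis using high[of m] \<open>j \<le> m\<close> by simp
    qed
    then show ?thesis by (simp only: w_def)
  qed
qed

text \<open>After \<open>green_representation\<close> the only unknown is \<open>L \<eta> 0\<close>.
  The difference between \<open>Suc m\<close> and \<open>m\<close> is affine in it with slope
  \<open>u (Suc m) - u m\<close>, which is nonzero, so letting that difference vanish determines the
  limit; \<omega> is the ratio that appears on solving.\<close>

lemma reflected_system_limit:
  fixes u v :: "nat \<Rightarrow> complex" and L :: "real \<Rightarrow> nat \<Rightarrow> complex" and \<rho> :: real and \<theta> \<kappa> :: complex
  assumes rho: "\<rho> > 0" and "Re \<theta> > 0" and u0: "u 0 = 1" and jm: "j \<le> m" and im: "i \<le> m"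
    and u_rec: "\<And>i. of_real \<rho> * u (Suc i) = (\<theta> + of_real \<rho> + of_nat i) * u i - of_nat i * u (i - 1)"
    and v_rec: "\<And>i. i > 0 \<Longrightarrow>
      of_real \<rho> * v (Suc i) = (\<theta> + of_real \<rho> + of_nat i) * v i - of_nat i * v (i - 1)"
    and \<kappa>: "\<kappa> * (u (Suc j) * v j - u j * v (Suc j)) = 1 / of_real \<rho>"
    and L_rec: "\<And>\<eta> i. \<eta> > 0 \<Longrightarrow> i \<le> m \<Longrightarrow> of_real \<rho> * L \<eta> (Suc i) =
      (\<theta> + of_real \<rho> + of_nat i) * L \<eta> i - of_nat i * L \<eta> (i - 1) - (if i = j then 1 else 0)"
    and L_lim: "((\<lambda>\<eta>. L \<eta> (Suc m) - L \<eta> m) \<longlongrightarrow> 0) at_top"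
    and \<omega>: "\<omega> = - ((v (Suc m) - v m) / (u (Suc m) - u m))"
  shows "((\<lambda>\<eta>. L \<eta> i) \<longlongrightarrow> (if i \<le> j then \<kappa> * u i * (v j + \<omega> * u j) else \<kappa> * u j * (v i + \<omega> * u i))) at_top"
proof -
  have \<Delta>: "u (Suc m) - u m \<noteq> 0"
    using norm_increasing_recurrence[OF rho \<open>Re \<theta> > 0\<close> _ u_rec, of m] u0 by auto
  have rep: "i \<le> j \<Longrightarrow> L \<eta> i = L \<eta> 0 * u i"
    "j \<le> i \<Longrightarrow> i \<le> Suc m \<Longrightarrow> L \<eta> i = L \<eta> 0 * u i - \<kappa> * (u i * v j - u j * v i)"
    if "\<eta> > 0" for \<eta> i
    by (rule green_representation[of \<rho> u j m \<theta> v \<kappa> "L \<eta>", OF _ u0 jm u_rec v_rec \<kappa> L_rec[OF that]];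
        use rho in simp)+
  define D where "D \<eta> = L \<eta> (Suc m) - L \<eta> m" for \<eta>
  have L0: "L \<eta> 0 = D \<eta> / (u (Suc m) - u m) + \<kappa> * (v j + \<omega> * u j)" if "\<eta> > 0" for \<eta>
  proof -
    have "D \<eta> = L \<eta> 0 * (u (Suc m) - u m)
       - \<kappa> * ((u (Suc m) - u m) * v j - u j * (v (Suc m) - v m))"
      unfolding D_def rep(2)[OF that le_SucI[OF jm] order_refl] rep(2)[OF that jm le_SucI[OF order_refl]]
      by (simp add: algebra_simps)
    with \<Delta> show ?thesis
      by (simp add: \<omega> divide_simps)
  qed
  have "(D \<longlongrightarrow> 0) at_top" using L_lim by (simp add: D_def[abs_def])
  then have "((\<lambda>\<eta>. D \<eta> / (u (Suc m) - u m) + \<kappa> * (v j + \<omega> * u j)) \<longlongrightarrow>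
      0 / (u (Suc m) - u m) + \<kappa> * (v j + \<omega> * u j)) at_top"
    using \<Delta> by (intro tendsto_intros)
  then have "((\<lambda>\<eta>. D \<eta> / (u (Suc m) - u m) + \<kappa> * (v j + \<omega> * u j)) \<longlongrightarrow> \<kappa> * (v j + \<omega> * u j)) at_top"
    by simp
  then have L0_lim: "((\<lambda>\<eta>. L \<eta> 0) \<longlongrightarrow> \<kappa> * (v j + \<omega> * u j)) at_top"
    by (rule Lim_transform_eventually)
      (intro eventually_mono[OF eventually_gt_at_top[of 0]] L0[symmetric])
  show ?thesis
  proof (cases "i \<le> j")
    case True
    have "((\<lambda>\<eta>. L \<eta> 0 * u i) \<longlongrightarrow> \<kappa> * (v j + \<omega> * u j) * u i) at_top"
      by (intro tendsto_intros L0_lim)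
    then have "((\<lambda>\<eta>. L \<eta> i) \<longlongrightarrow> \<kappa> * (v j + \<omega> * u j) * u i) at_top"
      by (rule Lim_transform_eventually)
        (intro eventually_mono[OF eventually_gt_at_top[of 0]] rep(1)[symmetric] True)
    then show ?thesis using True by (simp add: mult_ac)
  next
    case False
    have "((\<lambda>\<eta>. L \<eta> 0 * u i - \<kappa> * (u i * v j - u j * v i)) \<longlongrightarrow>
       \<kappa> * (v j + \<omega> * u j) * u i - \<kappa> * (u i * v j - u j * v i)) at_top"
      by (intro tendsto_intros L0_lim)
    then have "((\<lambda>\<eta>. L \<eta> i) \<longlongrightarrow> \<kappa> * (v j + \<omega> * u j) * u i - \<kappa> * (u i * v j - u j * v i)) at_top"
      by (rule Lim_transform_eventually)
        (rule eventually_mono[OF eventually_gt_at_top[of 0]], rule rep(2)[symmetric];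
         use False im in simp)
    then show ?thesis using False by (simp add: algebra_simps)
  qed
qed

section \<open>Resolvent equations of a transition function\<close>

lemma set_integrable_laplace:
  fixes g :: "real \<Rightarrow> real"
  assumes "Re \<theta> > 0" and cont: "continuous_on {0..} g" and bound: "\<And>t. t \<ge> 0 \<Longrightarrow> \<bar>g t\<bar> \<le> B"
  shows "set_integrable lborel {0..} (\<lambda>t. exp (- \<theta> * of_real t) * of_real (g t))"
    and "norm (laplace_transform g \<theta>) \<le> B / Re \<theta>"
proof -
  define u where "u = Re \<theta>"
  have u: "u > 0" using assms(1) by (simp add: u_def)
  \<comment> \<open>The dominating integral is Euler's integral for \<open>0!\<close>, rescaled by
    \<open>u\<close>.\<close>
  have "has_bochner_integral lborel (\<lambda>x. exp (- (u * x)) * indicator {0..} x) (1 / u)"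
    using lborel_has_bochner_integral_real_affine_iff[of u "\<lambda>x. exp (- x) * indicator {0..} x" 1 0]
      has_bochner_integral_I0i_power_exp_m'[of 0] u
    by (simp add: indicator_def zero_le_mult_iff field_simps)
  from has_bochner_integral_mult_right[OF this, of B]
  have B_int: "has_bochner_integral lborel (\<lambda>x. B * (exp (- (u * x)) * indicator {0..} x)) (B / u)"
    by simp
  then have int: "set_integrable lborel {0..} (\<lambda>x. B * exp (- (u * x)))"
    and val: "(LINT x:{0..}|lborel. B * exp (- (u * x))) = B / u"
    by (auto simp: set_integrable_def set_lebesgue_integral_def has_bochner_integral_iff mult_ac)
  have le: "norm (exp (- \<theta> * of_real t) * of_real (g t)) \<le> B * exp (- (u * t))" if "t \<ge> 0" for t
    using bound[OF that] by (simp add: norm_mult u_def mult.commute)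
  show int': "set_integrable lborel {0..} (\<lambda>t. exp (- \<theta> * of_real t) * of_real (g t))"
  proof (rule set_integrable_bound[OF int])
    have "continuous_on {0..} (\<lambda>t. exp (- \<theta> * of_real t) * complex_of_real (g t))"
      by (intro continuous_intros cont)
    then show "set_borel_measurable lborel {0..} (\<lambda>t. exp (- \<theta> * of_real t) * of_real (g t))"
      by (simp add: set_borel_measurable_def borel_measurable_continuous_on_indicator)
    show "AE x in lborel. x \<in> {0..} \<longrightarrow>
        norm (exp (- \<theta> * of_real x) * of_real (g x)) \<le> norm (B * exp (- (u * x)))"
      using le by (intro AE_I2) (auto intro: order.trans[OF _ abs_ge_self])
  qed
  have "norm (laplace_transform g \<theta>) \<le> (LINT x:{0..}|lborel. norm (exp (- \<theta> * of_real x) * of_real (g x)))"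
    unfolding laplace_transform_def by (rule set_integral_norm_bound[OF int'])
  also have "\<dots> \<le> (LINT x:{0..}|lborel. B * exp (- (u * x)))"
    by (intro set_integral_mono set_integrable_norm int' int) (use le in auto)
  finally have "norm (laplace_transform g \<theta>) \<le> B / u"
    by (simp only: val)
  then show "norm (laplace_transform g \<theta>) \<le> B / Re \<theta>"
    by (simp only: u_def)
qed

lemma laplace_transform_shift:
  fixes g :: "real \<Rightarrow> real"
  assumes "Re \<theta> > 0" and cont: "continuous_on {0..} g" and bound: "\<And>t. t \<ge> 0 \<Longrightarrow> \<bar>g t\<bar> \<le> B"
    and "h \<ge> 0"
  shows "laplace_transform (\<lambda>t. g (h + t)) \<theta> =
    exp (\<theta> * of_real h) * (laplace_transform g \<theta> -
       integral {0..h} (\<lambda>t. exp (- \<theta> * of_real t) * of_real (g t)))"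
proof -
  define f where "f t = exp (- \<theta> * complex_of_real t) * complex_of_real (g t)" for t
  have f: "set_integrable lborel {0..} f"
    using set_integrable_laplace(1)[OF assms(1) cont bound] by (simp add: f_def[abs_def])
  have f1: "set_integrable lborel {0..h} f" and f2: "set_integrable lborel {h..} f"
    using \<open>h \<ge> 0\<close> by (auto intro: set_integrable_subset[OF f])
  have un: "{0..} = {0..h} \<union> {h..}" using \<open>h \<ge> 0\<close> by auto
  have "laplace_transform g \<theta> = (LINT t:{0..}|lborel. f t)"
    by (simp add: laplace_transform_def f_def)
  also have "\<dots> = (LINT t:{0..h}|lborel. f t) + (LINT t:{h..}|lborel. f t)"
    unfolding un
  proof (rule set_integral_Un_AE)
    show "AE x in lborel. \<not> (x \<in> {0..h} \<and> x \<in> {h..})"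
      using AE_lborel_singleton[of h] by eventually_elim auto
  qed (use f1 f2 in auto)
  finally have split: "laplace_transform g \<theta> = integral {0..h} f + (LINT t:{h..}|lborel. f t)"
    using set_borel_integral_eq_integral(2)[OF f1] by simp
  have "(LINT t:{h..}|lborel. f t) = (\<integral>t. indicator {h..} (h + 1 * t) *\<^sub>R f (h + 1 * t) \<partial>lborel)"
    unfolding set_lebesgue_integral_def by (subst lborel_integral_real_affine[of 1 _ h]) auto
  also have "\<dots> = (LINT t:{0..}|lborel. exp (- \<theta> * of_real h) * (exp (- \<theta> * of_real t) * of_real (g (h + t))))"
    unfolding set_lebesgue_integral_def
    by (intro Bochner_Integration.integral_cong)
      (auto simp: f_def indicator_def exp_add[symmetric] algebra_simps)
  also have "\<dots> = exp (- \<theta> * of_real h) * laplace_transform (\<lambda>t. g (h + t)) \<theta>"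
    by (simp add: laplace_transform_def)
  finally have "exp (\<theta> * of_real h) * (LINT t:{h..}|lborel. f t) =
      exp (\<theta> * of_real h) * exp (- \<theta> * of_real h) * laplace_transform (\<lambda>t. g (h + t)) \<theta>"
    by simp
  also have "exp (\<theta> * of_real h) * exp (- \<theta> * of_real h) = 1"
    by (simp add: exp_add[symmetric])
  finally show ?thesis using split by (simp add: f_def[abs_def])
qed

lemma tendsto_of_real_at_right_0: "filterlim (\<lambda>h. complex_of_real h) (at 0) (at_right 0)"
  unfolding filterlim_at by (auto intro!: tendsto_eq_intros simp: eventually_at_filter)

text \<open>Substitute for the rule that transforms a derivative: the difference quotient is taken
  in the shift, outside the integral, so \<open>g\<close> has to be continuous and bounded but not
  differentiable.\<close>

lemma laplace_transform_shift_deriv: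
  fixes g :: "real \<Rightarrow> real"
  assumes "Re \<theta> > 0" and cont: "continuous_on {0..} g" and bound: "\<And>t. t \<ge> 0 \<Longrightarrow> \<bar>g t\<bar> \<le> B"
  shows "((\<lambda>h. (laplace_transform (\<lambda>t. g (h + t)) \<theta> - laplace_transform g \<theta>) / of_real h)
     \<longlongrightarrow> \<theta> * laplace_transform g \<theta> - of_real (g 0)) (at_right 0)"
proof -
  define L where "L = laplace_transform g \<theta>"
  define f where "f t = exp (- \<theta> * complex_of_real t) * complex_of_real (g t)" for t
  define I where "I h = integral {0..h} f" for h
  have "((\<lambda>z. exp (\<theta> * z)) has_field_derivative \<theta>) (at 0)"
    by (auto intro!: derivative_eq_intros)
  then have "((\<lambda>z. (exp (\<theta> * z) - 1) / z) \<longlongrightarrow> \<theta>) (at 0)"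
    by (simp add: has_field_derivative_iff)
  from filterlim_compose[OF this tendsto_of_real_at_right_0]
  have 1: "((\<lambda>h. (exp (\<theta> * of_real h) - 1) / of_real h) \<longlongrightarrow> \<theta>) (at_right 0)" .
  have "continuous_on {0..} f"
    unfolding f_def by (intro continuous_intros cont)
  then have "continuous_on {0..1} f"
    by (rule continuous_on_subset) auto
  from integral_has_vector_derivative[OF this, of 0]
  have "(I has_vector_derivative f 0) (at_right 0)"
    by (simp add: at_within_Icc_at_right I_def[abs_def])
  then have "((\<lambda>h. (1 / norm (h - 0)) *\<^sub>R (I h - (I 0 + (h - 0) *\<^sub>R f 0))) \<longlongrightarrow> 0) (at_right 0)"
    unfolding has_vector_derivative_def has_derivative_within by blast
  then have "((\<lambda>h. I h / of_real h - of_real (g 0)) \<longlongrightarrow> 0) (at_right 0)"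
  proof (rule Lim_transform_eventually)
    show "\<forall>\<^sub>F h in at_right 0. (1 / norm (h - 0)) *\<^sub>R (I h - (I 0 + (h - 0) *\<^sub>R f 0))
        = I h / of_real h - of_real (g 0)"
      using eventually_at_right_less[of 0]
      by eventually_elim (simp add: I_def f_def scaleR_conv_of_real field_simps)
  qed
  then have 2: "((\<lambda>h. I h / of_real h) \<longlongrightarrow> of_real (g 0)) (at_right 0)"
    by (rule LIM_zero_cancel)
  have "((\<lambda>h. exp (\<theta> * of_real h)) \<longlongrightarrow> exp (\<theta> * of_real 0)) (at_right 0)"
    by (intro tendsto_intros)
  then have 3: "((\<lambda>h. exp (\<theta> * of_real h)) \<longlongrightarrow> 1) (at_right 0)" by simp
  have "((\<lambda>h. (exp (\<theta> * of_real h) - 1) / of_real h * L - exp (\<theta> * of_real h) * (I h / of_real h))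
      \<longlongrightarrow> \<theta> * L - 1 * of_real (g 0)) (at_right 0)"
    by (intro tendsto_intros 1 2 3)
  then have "((\<lambda>h. (exp (\<theta> * of_real h) - 1) / of_real h * L - exp (\<theta> * of_real h) * (I h / of_real h))
      \<longlongrightarrow> \<theta> * L - of_real (g 0)) (at_right 0)" by simp
  then show ?thesis
    unfolding L_def[symmetric]
  proof (rule Lim_transform_eventually)
    show "\<forall>\<^sub>F h in at_right 0. (exp (\<theta> * of_real h) - 1) / of_real h * L - exp (\<theta> * of_real h) * (I h / of_real h)
       = (laplace_transform (\<lambda>t. g (h + t)) \<theta> - L) / of_real h"
      using eventually_at_right_less[of 0]
    proof eventually_elim
      case (elim h)
      then have "laplace_transform (\<lambda>t. g (h + t)) \<theta> = exp (\<theta> * of_real h) * (L - I h)"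
        using laplace_transform_shift[OF assms(1) cont bound, of h]
        by (simp add: L_def I_def f_def[abs_def])
      then show ?case using elim by (simp add: divide_simps) (simp add: algebra_simps)
    qed
  qed
qed

context
  fixes P :: "nat \<Rightarrow> nat \<Rightarrow> real \<Rightarrow> real"
  assumes P: "transition_function P"
begin

lemma transition_nonneg: "t \<ge> 0 \<Longrightarrow> 0 \<le> P i j t"
  and transition_row_sums: "t \<ge> 0 \<Longrightarrow> (\<lambda>j. P i j t) sums 1"
  and transition_0: "P i j 0 = (if i = j then 1 else 0)"
  and transition_Chapman_Kolmogorov:
    "s \<ge> 0 \<Longrightarrow> t \<ge> 0 \<Longrightarrow> (\<lambda>k. P i k s * P k j t) sums P i j (s + t)"
  using P unfolding transition_function_def by blast+

lemma transition_le_1: "t \<ge> 0 \<Longrightarrow> P i j t \<le> 1"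
  using sum_le_suminf[OF sums_summable[OF transition_row_sums], of t "{j}" i]
    transition_nonneg sums_unique[OF transition_row_sums, of t i] by simp

text \<open>The omitted terms are nonnegative and each is at most \<open>P i k h\<close>, so
  together they are at most the mass outside \<open>A\<close>. The bound involves neither
  \<open>t\<close> nor \<open>j\<close>, hence survives the Laplace integral.\<close>

lemma transition_Chapman_Kolmogorov_approx:
  assumes "finite A" "h \<ge> 0" "t \<ge> 0"
  shows "\<bar>P i j (h + t) - (\<Sum>k\<in>A. P i k h * P k j t)\<bar> \<le> 1 - (\<Sum>k\<in>A. P i k h)"
proof -
  have 1: "(\<lambda>k. if k \<in> A then 0 else P i k h * P k j t) sums
      (P i j (h + t) - (\<Sum>k\<in>A. P i k h * P k j t))"
    by (rule sums_If_finite_set'[OF transition_Chapman_Kolmogorov]) (use assms in \<open>auto simp: sum_negf\<close>)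
  have 2: "(\<lambda>k. if k \<in> A then 0 else P i k h) sums (1 - (\<Sum>k\<in>A. P i k h))"
    by (rule sums_If_finite_set'[OF transition_row_sums]) (use assms in \<open>auto simp: sum_negf\<close>)
  have "0 \<le> P i j (h + t) - (\<Sum>k\<in>A. P i k h * P k j t)"
    by (rule sums_le[OF _ sums_zero 1]) (use assms transition_nonneg in auto)
  moreover have "P i j (h + t) - (\<Sum>k\<in>A. P i k h * P k j t) \<le> 1 - (\<Sum>k\<in>A. P i k h)"
    by (rule sums_le[OF _ 1 2])
      (use assms transition_nonneg transition_le_1 in \<open>auto intro!: mult_left_le\<close>)
  ultimately show ?thesis by simp
qed

text \<open>Keeping only the term \<open>k = i\<close> of Chapman--Kolmogorov bounds every increment
  over a step \<open>h\<close> by twice \<open>1 - P i i h\<close>. Continuity from the right at 0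
  thus gives a modulus uniform in time; a point to the left of \<open>x\<close> is handled by
  starting the step there.\<close>

lemma transition_continuous_on:
  assumes "(P i i \<longlongrightarrow> 1) (at_right 0)"
  shows "continuous_on {0..} (P i j)"
proof -
  have lip: "\<bar>P i j (h + t) - P i j t\<bar> \<le> 2 * \<bar>P i i h - 1\<bar>" if "h \<ge> 0" "t \<ge> 0" for h t
  proof -
    have "\<bar>P i j (h + t) - P i i h * P i j t\<bar> \<le> 1 - P i i h"
      using transition_Chapman_Kolmogorov_approx[of "{i}" h t i j] that by simp
    moreover have "\<bar>(P i i h - 1) * P i j t\<bar> \<le> \<bar>P i i h - 1\<bar> * 1"
      unfolding abs_mult by (rule mult_left_mono) (use transition_nonneg transition_le_1 that in auto)
    ultimately show ?thesis
      using transition_le_1[of h i i] that by (simp add: algebra_simps)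
  qed
  show ?thesis
    unfolding continuous_on_iff
  proof (intro ballI allI impI)
    fix x e :: real assume "x \<in> {0..}" "e > 0"
    then have "\<forall>\<^sub>F h in at_right 0. dist (P i i h) 1 < e / 2"
      using tendstoD[OF assms, of "e / 2"] by simp
    then obtain d where "d > 0" "\<forall>h>0. h < d \<longrightarrow> dist (P i i h) 1 < e / 2"
      unfolding eventually_at_right[OF zero_less_one] by blast
    then have d: "d > 0" "\<And>h. h > 0 \<Longrightarrow> h < d \<Longrightarrow> \<bar>P i i h - 1\<bar> < e / 2"
      by (simp_all add: dist_real_def)
    have "dist (P i j y) (P i j x) < e" if "y \<in> {0..}" "dist y x < d" for y
    proof (cases y x rule: linorder_cases)
      case less
      then show ?thesis
        using lip[of "x - y" y] d(2)[of "x - y"] that by (simp add: dist_real_def abs_minus_commute)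
    next
      case greater
      then show ?thesis
        using lip[of "y - x" x] d(2)[of "y - x"] that \<open>x \<in> {0..}\<close> by (simp add: dist_real_def)
    qed (use \<open>e > 0\<close> in auto)
    then show "\<exists>d>0. \<forall>y\<in>{0..}. dist y x < d \<longrightarrow> dist (P i j y) (P i j x) < e"
      using d(1) by blast
  qed
qed

text \<open>The Laplace transform of Kolmogorov's backward equation, obtained from the
  Chapman--Kolmogorov equation without differentiating \<open>P\<close> at positive times.\<close>

lemma resolvent_backward_equation:
  assumes deriv: "\<And>i j. (P i j has_real_derivative q i j) (at_right 0)"
    and A: "finite A" "i \<in> A" "(\<Sum>k\<in>A. q i k) = 0" and \<theta>: "Re \<theta> > 0"
  shows "\<theta> * laplace_transform (P i j) \<theta> - (if i = j then 1 else 0) =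
    (\<Sum>k\<in>A. of_real (q i k) * laplace_transform (P k j) \<theta>)"
proof -
  define L where "L k = laplace_transform (P k j) \<theta>" for k
  have lim: "((\<lambda>h. (P k l h - P k l 0) / h) \<longlongrightarrow> q k l) (at_right 0)" for k l
    using deriv[of k l] by (simp add: has_field_derivative_iff)
  have "(P k k \<longlongrightarrow> 1) (at_right 0)" for k
    using DERIV_continuous[OF deriv[of k k]] by (simp add: continuous_within transition_0)
  then have cont: "continuous_on {0..} (P k l)" for k l
    by (rule transition_continuous_on)
  have bound: "\<bar>P k l t\<bar> \<le> 1" if "t \<ge> 0" for k l t
    using transition_nonneg[OF that] transition_le_1[OF that] by simp
  note int = set_integrable_laplace(1)[OF \<theta> cont bound]
  \<comment> \<open>\<open>e h\<close> is the probability of being outside \<open>A\<close> at time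
    \<open>h\<close>, and \<open>E h\<close> is the corresponding error in Chapman--Kolmogorov,
    dominated by it.\<close>
  define e where "e h = 1 - (\<Sum>k\<in>A. P i k h)" for h
  define E where "E h t = P i j (h + t) - (\<Sum>k\<in>A. P i k h * P k j t)" for h t
  have cont_shift: "continuous_on {0..} (\<lambda>t. P i j (h + t))" if "h \<ge> 0" for h
    by (rule continuous_on_compose2[OF cont]) (use that in \<open>auto intro!: continuous_intros\<close>)
  have E_int: "set_integrable lborel {0..} (\<lambda>t. exp (- \<theta> * of_real t) * of_real (E h t))"
    and E_bound: "norm (laplace_transform (E h) \<theta>) \<le> e h / Re \<theta>" if "h \<ge> 0" for h
  proof -
    have "continuous_on {0..} (E h)" unfolding E_def
      by (intro continuous_intros cont cont_shift that)
    moreover have "\<bar>E h t\<bar> \<le> e h" if "t \<ge> 0" for t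
      unfolding E_def e_def using transition_Chapman_Kolmogorov_approx[OF A(1) \<open>h \<ge> 0\<close> that] .
    ultimately show "set_integrable lborel {0..} (\<lambda>t. exp (- \<theta> * of_real t) * of_real (E h t))"
      and "norm (laplace_transform (E h) \<theta>) \<le> e h / Re \<theta>"
      using set_integrable_laplace[OF \<theta>, of "E h" "e h"] by blast+
  qed
  have shift: "laplace_transform (\<lambda>t. P i j (h + t)) \<theta> =
      laplace_transform (E h) \<theta> + (\<Sum>k\<in>A. of_real (P i k h) * L k)" if "h \<ge> 0" for h
  proof -
    have "laplace_transform (\<lambda>t. P i j (h + t)) \<theta> =
       (LINT t:{0..}|lborel. exp (- \<theta> * of_real t) * of_real (E h t) +
         (\<Sum>k\<in>A. of_real (P i k h) * (exp (- \<theta> * of_real t) * of_real (P k j t))))"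
      unfolding laplace_transform_def
      by (intro set_lebesgue_integral_cong) 
        (auto simp: E_def algebra_simps sum_distrib_left)
    also have "\<dots> = laplace_transform (E h) \<theta> +
        (LINT t:{0..}|lborel. \<Sum>k\<in>A. of_real (P i k h) * (exp (- \<theta> * of_real t) * of_real (P k j t)))"
      unfolding laplace_transform_def
    proof (rule set_integral_add(2)[OF E_int[OF that]])
      show "set_integrable lborel {0..}
          (\<lambda>t. \<Sum>k\<in>A. of_real (P i k h) * (exp (- \<theta> * of_real t) * of_real (P k j t)))"
        unfolding set_integrable_def scaleR_sum_right
        by (intro Bochner_Integration.integrable_sum, fold set_integrable_def)
          (intro set_integrable_mult_right int)
    qed
    also have "(LINT t:{0..}|lborel. \<Sum>k\<in>A. of_real (P i k h) * (exp (- \<theta> * of_real t) * of_real (P k j t)))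
        = (\<Sum>k\<in>A. LINT t:{0..}|lborel. of_real (P i k h) * (exp (- \<theta> * of_real t) * of_real (P k j t)))"
      unfolding set_lebesgue_integral_def scaleR_sum_right
      by (intro Bochner_Integration.integral_sum, fold set_integrable_def)
        (intro set_integrable_mult_right int)
    also have "\<dots> = (\<Sum>k\<in>A. of_real (P i k h) * L k)"
      by (simp add: L_def laplace_transform_def)
    finally show ?thesis .
  qed
  have L_i: "(\<Sum>k\<in>A. of_real (P i k 0) * L k) = L i"
    using A(1,2) by (simp add: transition_0 if_distrib[of of_real] if_distrib[of "\<lambda>x. x * _"] cong: if_cong)
  have quot: "(laplace_transform (\<lambda>t. P i j (h + t)) \<theta> - L i) / of_real h =
      laplace_transform (E h) \<theta> / of_real h + (\<Sum>k\<in>A. of_real ((P i k h - P i k 0) / h) * L k)"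
    if "h > 0" for h
    using shift[of h] that
    by (simp add: L_i[symmetric] diff_divide_distrib add_divide_distrib sum_divide_distrib
        sum_subtractf algebra_simps)
  \<comment> \<open>Since \<open>A\<close> carries all the mass at time 0, \<open>e h / h\<close> is
    minus the sum of the difference quotients, so its limit is minus the sum of the rates over
    \<open>A\<close>, which is zero. Hence the error term disappears from the quotient.\<close>
  have "((\<lambda>h. (- (\<Sum>k\<in>A. (P i k h - P i k 0) / h)) / Re \<theta>) \<longlongrightarrow> (- (\<Sum>k\<in>A. q i k)) / Re \<theta>) (at_right 0)"
    by (intro tendsto_intros lim) (use \<theta> in auto)
  moreover have "(\<Sum>k\<in>A. P i k 0) = 1"
    using A(1,2) by (simp add: transition_0)
  ultimately have "((\<lambda>h. (e h / Re \<theta>) / h) \<longlongrightarrow> 0) (at_right 0)"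
    using A(3) by (simp add: e_def sum_divide_distrib[symmetric] sum_subtractf minus_divide_left mult.commute)
  moreover have "\<forall>\<^sub>F h in at_right 0. norm (laplace_transform (E h) \<theta> / of_real h) \<le> (e h / Re \<theta>) / h"
    using eventually_at_right_less[of 0]
  proof eventually_elim
    case (elim h)
    then show ?case
      using divide_right_mono[OF E_bound[of h], of h] by (simp add: norm_divide)
  qed
  ultimately have "((\<lambda>h. laplace_transform (E h) \<theta> / of_real h) \<longlongrightarrow> 0) (at_right 0)"
    by (rule Lim_null_comparison[rotated])
  then have "((\<lambda>h. laplace_transform (E h) \<theta> / of_real h + (\<Sum>k\<in>A. of_real ((P i k h - P i k 0) / h) * L k))
      \<longlongrightarrow> 0 + (\<Sum>k\<in>A. of_real (q i k) * L k)) (at_right 0)"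
    by (intro tendsto_intros lim)
  then have "((\<lambda>h. (laplace_transform (\<lambda>t. P i j (h + t)) \<theta> - L i) / of_real h)
      \<longlongrightarrow> 0 + (\<Sum>k\<in>A. of_real (q i k) * L k)) (at_right 0)"
    by (rule Lim_transform_eventually)
      (intro eventually_mono[OF eventually_at_right_less[of 0]] quot[symmetric])
  moreover have "((\<lambda>h. (laplace_transform (\<lambda>t. P i j (h + t)) \<theta> - L i) / of_real h)
      \<longlongrightarrow> \<theta> * L i - of_real (P i j 0)) (at_right 0)"
    unfolding L_def by (rule laplace_transform_shift_deriv[OF \<theta> cont bound])
  ultimately have "0 + (\<Sum>k\<in>A. of_real (q i k) * L k) = \<theta> * L i - of_real (P i j 0)"
    by (rule tendsto_unique[rotated]) simp
  then show ?thesis by (simp add: L_def transition_0)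
qed

end


section \<open>The Erlang A process and the limit of fast abandonment\<close>

lemma erlang_A_resolvent_equation:
  fixes P :: "nat \<Rightarrow> nat \<Rightarrow> real \<Rightarrow> real"
  assumes P: "transition_function P"
    and deriv: "\<And>i j. (P i j has_real_derivative
      birth_death_rate (\<lambda>_. \<rho>) (erlang_A_death m \<eta>) i j) (at_right 0)"
    and \<theta>: "Re \<theta> > 0"
  shows "of_real \<rho> * laplace_transform (P (Suc i) j) \<theta> =
      (\<theta> + of_real \<rho> + of_real (erlang_A_death m \<eta> i)) * laplace_transform (P i j) \<theta>
      - of_real (erlang_A_death m \<eta> i) * laplace_transform (P (i - 1) j) \<theta>
      - (if i = j then 1 else 0)"
proof (cases i)
  case 0
  \<comment> \<open>State 0 has one neighbour. Its death rate is 0, so the term with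
    \<open>i - 1\<close>, which here is 0 again, drops out of the equation.\<close>
  have "(\<Sum>k\<in>{0, Suc 0}. birth_death_rate (\<lambda>_. \<rho>) (erlang_A_death m \<eta>) 0 k) = 0"
    by (simp add: birth_death_rate_def erlang_A_death_def)
  from resolvent_backward_equation[OF P deriv _ _ this \<theta>, of j]
  show ?thesis using 0
    by (simp add: birth_death_rate_def erlang_A_death_def algebra_simps)
next
  case (Suc l)
  have "(\<Sum>k\<in>{l, Suc l, Suc (Suc l)}. birth_death_rate (\<lambda>_. \<rho>) (erlang_A_death m \<eta>) (Suc l) k) = 0"
    by (simp add: birth_death_rate_def)
  from resolvent_backward_equation[OF P deriv _ _ this \<theta>, of j]
  show ?thesis using Suc
    by (simp add: birth_death_rate_def algebra_simps)
qed

lemma laplace_transform_transition_bound: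
  fixes P :: "nat \<Rightarrow> nat \<Rightarrow> real \<Rightarrow> real"
  assumes P: "transition_function P"
    and deriv: "(P i i has_real_derivative q) (at_right 0)" and \<theta>: "Re \<theta> > 0"
  shows "norm (laplace_transform (P i j) \<theta>) \<le> 1 / Re \<theta>"
proof (rule set_integrable_laplace(2)[OF \<theta>])
  have "(P i i \<longlongrightarrow> 1) (at_right 0)"
    using DERIV_continuous[OF deriv] by (simp add: continuous_within transition_0[OF P])
  then show "continuous_on {0..} (P i j)"
    by (rule transition_continuous_on[OF P])
  show "\<bar>P i j t\<bar> \<le> 1" if "t \<ge> 0" for t
    using transition_nonneg[OF P that] transition_le_1[OF P that] by simp
qed

text \<open>Connects the process with the analysis: almost sure start in \<open>n\<^sub>0\<close>
  makes the conditioning event have probability 1, and conditioning on it yields row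
  \<open>n\<^sub>0\<close> of the transition function. The Markov property speaks of strictly
  increasing times, so \<open>t = 0\<close> is settled separately by the initial condition of
  \<open>P\<close>.\<close>

lemma erlang_A_process_transition_function:
  assumes "erlang_A_process m \<rho> \<eta> n\<^sub>0 M X"
  obtains P where "transition_function P"
    and "\<And>i j. (P i j has_real_derivative
      birth_death_rate (\<lambda>_. \<rho>) (erlang_A_death m \<eta>) i j) (at_right 0)"
    and "\<And>n t. t \<ge> 0 \<Longrightarrow> \<P>(x in M. X t x = n \<bar> X 0 x = n\<^sub>0) = P n\<^sub>0 n t"
proof -
  from assms obtain P where P: "transition_function P"
    and deriv: "\<And>i j. (P i j has_real_derivative
      birth_death_rate (\<lambda>_. \<rho>) (erlang_A_death m \<eta>) i j) (at_right 0)"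
    and markov: "markov_process M X P" and start: "AE x in M. X 0 x = n\<^sub>0"
    unfolding erlang_A_process_def birth_death_process_def by blast
  interpret prob_space M using markov by (simp add: markov_process_def)
  have [measurable]: "X 0 \<in> measurable M (count_space UNIV)"
    using markov by (simp add: markov_process_def)
  have prob_start: "\<P>(x in M. X 0 x = n\<^sub>0) = 1"
    using start by (subst prob_Collect_eq_1) auto
  have "\<P>(x in M. X t x = n \<bar> X 0 x = n\<^sub>0) = P n\<^sub>0 n t" if "t \<ge> 0" for n t
  proof (cases "t = 0")
    case True
    then show ?thesis
      using prob_start transition_0[OF P] by (auto simp: cond_prob_def cong: conj_cong)
  next
    case False
    \<comment> \<open>The Markov property is instantiated with the two times 0 and \<open>t\<close>,
      that is with an empty past before the conditioning time.\<close>
    define s :: "nat \<Rightarrow> real" where "s l = real l * t" for l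
    define i where "i l = (if l = 0 then n\<^sub>0 else n)" for l :: nat
    have "\<P>(x in M. X (s (Suc 0)) x = i (Suc 0) \<bar> \<forall>l\<le>0. X (s l) x = i l)
        = P (i 0) (i (Suc 0)) (s (Suc 0) - s 0)"
      if "0 \<le> s 0" "\<forall>l\<le>0. s l < s (Suc l)" "0 < \<P>(x in M. \<forall>l\<le>0. X (s l) x = i l)"
      using markov that unfolding markov_process_def by blast
    moreover have "0 < t" using that False by simp
    ultimately have "\<P>(x in M. X (s (Suc 0)) x = i (Suc 0) \<bar> \<forall>l\<le>0. X (s l) x = i l)
        = P (i 0) (i (Suc 0)) (s (Suc 0) - s 0)"
      using prob_start by (simp add: s_def i_def)
    then show ?thesis by (simp add: s_def i_def)
  qed
  with P deriv show ?thesis by (rule that)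
qed

lemma erlang_A_reflection_limit:
  fixes L :: "real \<Rightarrow> nat \<Rightarrow> complex"
  assumes rec: "\<And>\<eta>. \<eta> > 0 \<Longrightarrow> of_real \<rho> * L \<eta> (Suc (Suc m)) =
      (\<theta> + of_real \<rho> + of_real (real m + \<eta>)) * L \<eta> (Suc m) - of_real (real m + \<eta>) * L \<eta> m"
    and bound: "\<And>\<eta> i. \<eta> > 0 \<Longrightarrow> norm (L \<eta> i) \<le> B"
  shows "((\<lambda>\<eta>. L \<eta> (Suc m) - L \<eta> m) \<longlongrightarrow> 0) at_top"
proof (rule Lim_null_comparison)
  define C where "C = (\<bar>\<rho>\<bar> + norm (\<theta> + of_real \<rho>)) * B"
  show "\<forall>\<^sub>F \<eta> in at_top. norm (L \<eta> (Suc m) - L \<eta> m) \<le> C / (real m + \<eta>)"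
    using eventually_gt_at_top[of 0]
  proof eventually_elim
    case (elim \<eta>)
    \<comment> \<open>Both terms with a large coefficient combine into one multiple of the
      difference; everything else is bounded independently of \<eta>, giving the rate
      \<open>1 / (m + \<eta>)\<close>.\<close>
    have "of_real (real m + \<eta>) * (L \<eta> (Suc m) - L \<eta> m)
        = of_real \<rho> * L \<eta> (Suc (Suc m)) - (\<theta> + of_real \<rho>) * L \<eta> (Suc m)"
      using rec[OF elim] by (simp add: algebra_simps)
    then have "norm (of_real (real m + \<eta>) * (L \<eta> (Suc m) - L \<eta> m))
        \<le> \<bar>\<rho>\<bar> * norm (L \<eta> (Suc (Suc m))) + norm (\<theta> + of_real \<rho>) * norm (L \<eta> (Suc m))"
      by (metis norm_mult norm_of_real norm_triangle_ineq4)
    also have "\<dots> \<le> C"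
      unfolding C_def distrib_right by (intro add_mono mult_left_mono bound elim) auto
    finally have "(real m + \<eta>) * norm (L \<eta> (Suc m) - L \<eta> m) \<le> C"
      using elim by (simp add: norm_mult del: of_real_add)
    then show ?case
      using elim by (simp add: field_simps)
  qed
  show "((\<lambda>\<eta>. C / (real m + \<eta>)) \<longlongrightarrow> 0) at_top"
    by (intro tendsto_divide_0[OF tendsto_const] filterlim_at_top_imp_at_infinity
        filterlim_tendsto_add_at_top[OF tendsto_const] filterlim_ident)
qed

section \<open>Integrals along the Hankel contour\<close>

text \<open>The cut of \<open>(z - 1) powr a\<close> is removed; since it contains 0, the pole of
  \<open>1 / z ^ k\<close> goes with it. What remains is starlike, so the integrands have global
  primitives there.\<close>

definition slit_plane :: "complex set" where
  "slit_plane = - (complex_of_real ` {..1})"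

lemma slit_plane_iff: "z \<in> slit_plane \<longleftrightarrow> Im z \<noteq> 0 \<or> Re z > 1"
  by (auto simp: slit_plane_def image_iff complex_eq_iff not_le)

lemma open_slit_plane: "open slit_plane"
proof -
  have "slit_plane = {z. Im z \<noteq> 0} \<union> {z. Re z > 1}"
    by (auto simp: slit_plane_iff)
  moreover have "open {z. Im z \<noteq> 0}" "open {z. Re z > 1}"
    by (intro open_Collect_neq open_Collect_less continuous_intros)+
  ultimately show ?thesis by (metis open_Un)
qed

lemma slit_plane_primitive:
  assumes "f holomorphic_on slit_plane"
  obtains g where "\<And>z. z \<in> slit_plane \<Longrightarrow> (g has_field_derivative f z) (at z)"
proof -
  have "\<exists>g. \<forall>z\<in>slit_plane. (g has_field_derivative f z) (at z)"
  proof (rule holomorphic_starlike_primitive[where k = "{}"])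
    show "starlike slit_plane"
      unfolding slit_plane_def by (rule starlike_slotted_complex_plane_left)
    show "f field_differentiable at x" if "x \<in> slit_plane - {}" for x
      using that assms open_slit_plane by (auto simp: holomorphic_on_open field_differentiable_def)
  qed (use assms open_slit_plane in \<open>auto intro: holomorphic_on_imp_continuous_on\<close>)
  then show ?thesis using that by blast
qed

lemma has_field_derivative_powr_slit_plane:
  assumes "z \<in> slit_plane"
  shows "((\<lambda>z. (z - 1) powr a) has_field_derivative a * (z - 1) powr (a - 1)) (at z)"
proof -
  have "z - 1 \<notin> \<real>\<^sub>\<le>\<^sub>0"
    using assms by (auto simp: slit_plane_iff complex_nonpos_Reals_iff)
  moreover have "((\<lambda>z. z - 1) has_field_derivative 1) (at z)"
    by (auto intro!: derivative_eq_intros)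
  ultimately show ?thesis
    using DERIV_chain2[of "\<lambda>z. z powr a" _ "\<lambda>z. z - 1" z 1 UNIV] has_field_derivative_powr by fastforce
qed

lemma holomorphic_on_powr_slit_plane: "(\<lambda>z. (z - 1) powr a) holomorphic_on slit_plane"
  using has_field_derivative_powr_slit_plane open_slit_plane
  by (auto simp: holomorphic_on_open)

context
  fixes \<epsilon> :: real
  assumes \<epsilon>: "\<epsilon> > 0"
begin

lemma valid_path_hankel_path: "valid_path (hankel_path \<epsilon> R)"
  and pathstart_hankel_path: "pathstart (hankel_path \<epsilon> R) = Complex (- R) (- \<epsilon>)"
  and pathfinish_hankel_path: "pathfinish (hankel_path \<epsilon> R) = Complex (- R) \<epsilon>"
  and path_image_hankel_path: "path_image (hankel_path \<epsilon> R) \<subseteq> slit_plane"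
proof -
  have 1: "1 + of_real \<epsilon> * exp (\<i> * of_real (- (pi / 2))) = Complex 1 (- \<epsilon>)"
    by (simp add: complex_eq_iff Re_exp Im_exp)
  have 2: "1 + of_real \<epsilon> * exp (\<i> * of_real (pi / 2)) = Complex 1 \<epsilon>"
    by (simp add: complex_eq_iff Re_exp Im_exp)
  show "valid_path (hankel_path \<epsilon> R)"
    unfolding hankel_path_def using 1 2
    by (intro valid_path_join valid_path_linepath valid_path_part_circlepath) simp_all
  show "pathstart (hankel_path \<epsilon> R) = Complex (- R) (- \<epsilon>)"
    "pathfinish (hankel_path \<epsilon> R) = Complex (- R) \<epsilon>"
    by (simp_all add: hankel_path_def)
  have arc: "path_image (part_circlepath 1 \<epsilon> (- (pi / 2)) (pi / 2)) \<subseteq> slit_plane"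
  proof
    fix z assume "z \<in> path_image (part_circlepath 1 \<epsilon> (- (pi / 2)) (pi / 2))"
    then obtain x where x: "- (pi / 2) \<le> x" "x \<le> pi / 2" and z: "z = 1 + of_real \<epsilon> * cis x"
      by (auto simp: path_image_part_circlepath' closed_segment_eq_real_ivl)
    \<comment> \<open>At the two ends of the arc the real part is exactly 1 and the imaginary part
      has to be used; elsewhere the cosine is positive.\<close>
    show "z \<in> slit_plane"
    proof (cases "\<bar>x\<bar> = pi / 2")
      case True
      then have "x = pi / 2 \<or> x = - (pi / 2)" by linarith
      then have "sin x \<noteq> 0" by (metis sin_minus sin_pi_half zero_neq_one neg_equal_0_iff_equal)
      then show ?thesis using \<epsilon> by (simp add: slit_plane_iff z)
    next
      case False
      with x have "cos x > 0" by (intro cos_gt_zero_pi) linarith+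
      then show ?thesis using \<epsilon> by (simp add: slit_plane_iff z)
    qed
  qed
  show "path_image (hankel_path \<epsilon> R) \<subseteq> slit_plane"
    unfolding hankel_path_def
    by (intro subset_path_image_join arc)
      (use \<epsilon> in \<open>auto simp: closed_segment_same_Im slit_plane_iff\<close>)
qed

text \<open>Reduces every question about the truncated contour to the values of a primitive at the
  two ends \<open>- R\<close> plus or minus \<open>\<i> * \<epsilon>\<close>.\<close>

lemma has_contour_integral_hankel_path:
  assumes "\<And>z. z \<in> slit_plane \<Longrightarrow> (g has_field_derivative f z) (at z)"
  shows "(f has_contour_integral g (Complex (- R) \<epsilon>) - g (Complex (- R) (- \<epsilon>))) (hankel_path \<epsilon> R)"
  using contour_integral_primitive[of slit_plane g f, OF _ valid_path_hankel_path path_image_hankel_path]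
    assms by (simp add: pathstart_hankel_path pathfinish_hankel_path has_field_derivative_at_within)

lemma contour_integrable_hankel_path:
  assumes "f holomorphic_on slit_plane"
  shows "f contour_integrable_on (hankel_path \<epsilon> R)"
  using slit_plane_primitive[OF assms] has_contour_integral_hankel_path
  by (metis has_contour_integral_integrable)

end

text \<open>The modulus of \<open>w powr a\<close> is \<open>norm w powr Re a\<close> times an
  exponential of the argument, which is bounded by \<open>pi\<close>. Because
  \<open>norm w \<ge> 1\<close>, the exponent may be replaced by its absolute value. Uniformity in
  \<open>y\<close> is needed for vertical segments, not just for the rays.\<close>

lemma norm_hankel_integrand_le:
  assumes "R \<ge> 0" "\<bar>y\<bar> \<le> \<epsilon>"
  shows "norm (exp (of_real \<rho> * Complex (- R) y) * (Complex (- R) y - 1) powr a)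
    \<le> exp (- \<rho> * R) * (R + 1 + \<epsilon>) powr \<bar>Re a\<bar> * exp (pi * \<bar>Im a\<bar>)"
proof -
  define w where "w = Complex (- R) y - 1"
  have ge: "norm w \<ge> 1" using abs_Re_le_cmod[of w] assms by (simp add: w_def)
  have le: "norm w \<le> R + 1 + \<epsilon>" using cmod_le[of w] assms by (simp add: w_def)
  have "norm w powr Re a \<le> norm w powr \<bar>Re a\<bar>"
    using ge by (intro powr_mono) auto
  also have "\<dots> \<le> (R + 1 + \<epsilon>) powr \<bar>Re a\<bar>"
    using ge le by (intro powr_mono2) auto
  finally have 1: "norm w powr Re a \<le> (R + 1 + \<epsilon>) powr \<bar>Re a\<bar>" .
  have "- Im a * Arg w \<le> \<bar>Im a\<bar> * \<bar>Arg w\<bar>"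
    by (metis abs_ge_self abs_minus_cancel abs_mult)
  also have "\<dots> \<le> \<bar>Im a\<bar> * pi"
    using mpi_less_Arg[of w] Arg_le_pi[of w] by (intro mult_left_mono) auto
  finally have 2: "exp (- Im a * Arg w) \<le> exp (pi * \<bar>Im a\<bar>)" by (simp add: mult.commute)
  have "norm (exp (of_real \<rho> * Complex (- R) y) * w powr a)
      = exp (- \<rho> * R) * (norm w powr Re a * exp (- Im a * Arg w))"
    by (simp add: norm_mult norm_powr_complex)
  also have "\<dots> \<le> exp (- \<rho> * R) * ((R + 1 + \<epsilon>) powr \<bar>Re a\<bar> * exp (pi * \<bar>Im a\<bar>))"
    by (intro mult_left_mono mult_mono 1 2) auto
  finally show ?thesis by (simp add: w_def mult_ac)
qed

lemma hankel_bound_tendsto_0: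
  fixes \<rho> b C \<epsilon> :: real
  assumes "\<rho> > 0"
  shows "((\<lambda>R. exp (- \<rho> * R) * (R + 1 + \<epsilon>) powr b * C) \<longlongrightarrow> 0) at_top"
proof -
  have "((\<lambda>R. exp (- \<rho> * R) * (R + 1 + \<epsilon>) powr b) \<longlongrightarrow> 0) at_top"
    using assms by real_asymp
  then show ?thesis by (rule tendsto_mult_left_zero)
qed

lemma hankel_end_tendsto_0:
  assumes "\<rho> > 0"
  shows "((\<lambda>R. exp (of_real \<rho> * Complex (- R) y) * (Complex (- R) y - 1) powr a) \<longlongrightarrow> 0) at_top"
  by (rule Lim_null_comparison[OF _ hankel_bound_tendsto_0[OF assms]],
      rule eventually_mono[OF eventually_ge_at_top[of 0]], rule norm_hankel_integrand_le[OF _ order_refl])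

text \<open>Comparison with the primitive \<open>- exp (- c * x) / c\<close> bounds all increments
  beyond \<open>x\<close> by the tail \<open>exp (- c * x) / c\<close>. The limit is found along the
  integers; letting the second endpoint run through them in the same bound extends the convergence
  to all real arguments.\<close>

lemma tendsto_at_top_if_deriv_exp_bounded:
  fixes h :: "real \<Rightarrow> complex"
  assumes c: "c > 0"
    and deriv: "\<And>x. x \<ge> a \<Longrightarrow> (h has_vector_derivative h' x) (at x)"
    and bound: "\<And>x. x \<ge> a \<Longrightarrow> norm (h' x) \<le> exp (- c * x)"
  shows "\<exists>l. (h \<longlongrightarrow> l) at_top"
proof -
  have diff: "norm (h y - h x) \<le> exp (- c * x) / c" if "a \<le> x" "x \<le> y" for x y
  proof (cases "x = y")
    case False
    have "norm (h y - h x) \<le> (- exp (- c * y) / c) - (- exp (- c * x) / c)"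
    proof (rule differentiable_bound_general[where f' = h' and \<phi>' = "\<lambda>x. exp (- c * x)"])
      show "continuous_on {x..y} h"
        by (intro continuous_at_imp_continuous_on ballI has_vector_derivative_continuous[OF deriv])
          (use that in auto)
      show "continuous_on {x..y} (\<lambda>x. - exp (- c * x) / c)"
        using c by (intro continuous_intros) auto
      show "((\<lambda>x. - exp (- c * x) / c) has_vector_derivative exp (- c * t)) (at t)" for t
        unfolding has_real_derivative_iff_has_vector_derivative[symmetric]
        using c by (auto intro!: derivative_eq_intros)
    qed (use that False deriv bound in auto)
    also have "\<dots> \<le> exp (- c * x) / c" using c by simp
    finally show ?thesis .
  qed (use c in auto)
  have lim0: "((\<lambda>x. exp (- c * x) / c) \<longlongrightarrow> 0) at_top"
    using c by real_asymp
  have lim0': "(\<lambda>n. exp (- c * real n) / c) \<longlonglongrightarrow> 0"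
    by (rule filterlim_compose[OF lim0 filterlim_real_sequentially])
  have "Cauchy (\<lambda>n. h (real n))"
  proof (rule metric_CauchyI)
    fix e :: real assume "e > 0"
    then have "\<forall>\<^sub>F n in sequentially. exp (- c * real n) / c < e / 2 \<and> a \<le> real n"
      using order_tendstoD(2)[OF lim0', of "e / 2"]
        eventually_ge_at_top[of a, THEN filterlim_real_sequentially[THEN filterlim_iff[THEN iffD1, rule_format]]]
      by (simp add: eventually_conj)
    then obtain K where K: "exp (- c * real K) / c < e / 2" "a \<le> real K"
      by (auto simp: eventually_sequentially)
    have near: "dist (h (real n)) (h (real K)) < e / 2" if "n \<ge> K" for n
      unfolding dist_norm
      by (rule order.strict_trans1[OF diff K(1)]) (use K(2) that in auto)
    have "dist (h (real m)) (h (real n)) < e" if "m \<ge> K" "n \<ge> K" for m n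
      using near[OF that(1)] near[OF that(2)] by (metis dist_commute dist_triangle_half_r)
    then show "\<exists>K. \<forall>m\<ge>K. \<forall>n\<ge>K. dist (h (real m)) (h (real n)) < e" by blast
  qed
  then obtain l where l: "(\<lambda>n. h (real n)) \<longlonglongrightarrow> l"
    by (auto simp: Cauchy_convergent_iff convergent_def)
  have bound_l: "norm (h x - l) \<le> exp (- c * x) / c" if "a \<le> x" for x
  proof (rule LIMSEQ_le_const2)
    show "(\<lambda>n. norm (h x - h (real n))) \<longlonglongrightarrow> norm (h x - l)"
      by (intro tendsto_intros l)
    obtain K where "x \<le> real K" using real_arch_simple by blast
    then show "\<exists>N. \<forall>n\<ge>N. norm (h x - h (real n)) \<le> exp (- c * x) / c"
      by (intro exI[of _ K] allI impI, subst norm_minus_commute, intro diff[OF that]) linarith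
  qed
  have "((\<lambda>x. h x - l) \<longlongrightarrow> 0) at_top"
    by (rule Lim_null_comparison[OF eventually_mono[OF eventually_ge_at_top[of a] bound_l] lim0])
  then show ?thesis by (auto dest: LIM_zero_cancel)
qed

text \<open>The exponential is split into two factors with \<open>\<rho> / 2\<close>: one absorbs
  the possibly growing power, the other is the decay rate. The factor \<open>1 / z ^ k\<close> is
  harmless once \<open>norm z \<ge> 1\<close>.\<close>

lemma hankel_ray_converges:
  assumes \<rho>: "\<rho> > 0" and y: "y \<noteq> 0"
    and g: "\<And>z. z \<in> slit_plane \<Longrightarrow>
      (g has_field_derivative exp (of_real \<rho> * z) / (z ^ k * (z - 1) powr \<theta>)) (at z)"
  shows "\<exists>l. ((\<lambda>R. g (Complex (- R) y)) \<longlongrightarrow> l) at_top"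
proof -
  define f where "f z = exp (of_real \<rho> * z) / (z ^ k * (z - 1) powr \<theta>)" for z
  have "((\<lambda>R. exp (of_real (\<rho> / 2) * Complex (- R) y) * (Complex (- R) y - 1) powr (- \<theta>)) \<longlongrightarrow> 0) at_top"
    using \<rho> by (intro hankel_end_tendsto_0) auto
  then have "\<forall>\<^sub>F R in at_top. norm (exp (of_real (\<rho> / 2) * Complex (- R) y) * (Complex (- R) y - 1) powr (- \<theta>)) < 1"
    using order_tendstoD(2)[OF tendsto_norm, of _ 0 at_top 1] by simp
  then have "\<forall>\<^sub>F R in at_top. 1 \<le> R \<and>
      norm (exp (of_real (\<rho> / 2) * Complex (- R) y) * (Complex (- R) y - 1) powr (- \<theta>)) < 1"
    using eventually_ge_at_top[of 1] by (rule eventually_conj[rotated])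
  then obtain a where a: "\<And>R. R \<ge> a \<Longrightarrow> 1 \<le> R \<and>
      norm (exp (of_real (\<rho> / 2) * Complex (- R) y) * (Complex (- R) y - 1) powr (- \<theta>)) < 1"
    by (auto simp: eventually_at_top_linorder)
  have bound: "norm (- f (Complex (- R) y)) \<le> exp (- (\<rho> / 2) * R)" if "R \<ge> a" for R
  proof -
    define z where "z = Complex (- R) y"
    have "norm z \<ge> 1" using abs_Re_le_cmod[of z] a[OF that] by (simp add: z_def)
    then have "1 \<le> norm z ^ k" by simp
    have "f z = exp (of_real (\<rho> / 2) * z) * (exp (of_real (\<rho> / 2) * z) * (z - 1) powr (- \<theta>)) / z ^ k"
      by (simp add: f_def powr_minus exp_add[symmetric] field_simps)
    then have "norm (f z) = norm (exp (of_real (\<rho> / 2) * z)) *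
        norm (exp (of_real (\<rho> / 2) * z) * (z - 1) powr (- \<theta>)) / norm z ^ k"
      by (simp only: norm_mult norm_divide norm_power)
    also have "\<dots> \<le> norm (exp (of_real (\<rho> / 2) * z)) * 1 / 1"
      using a[OF that] \<open>1 \<le> norm z ^ k\<close> unfolding z_def[symmetric]
      by (intro frac_le mult_left_mono) auto
    also have "\<dots> = exp (- (\<rho> / 2) * R)" by (simp add: z_def)
    finally show ?thesis by (simp add: z_def)
  qed
  show ?thesis
  proof (rule tendsto_at_top_if_deriv_exp_bounded[OF _ _ bound])
    show "0 < \<rho> / 2" using \<rho> by simp
    show "((\<lambda>R. g (Complex (- R) y)) has_vector_derivative - f (Complex (- R) y)) (at R)" for R
    proof -
      have line: "((\<lambda>R. Complex (- R) y) has_vector_derivative - 1) (at R)"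
        by (auto simp: has_vector_derivative_complex_iff intro!: derivative_eq_intros)
      have "(g has_field_derivative f (Complex (- R) y)) (at (Complex (- R) y))"
        unfolding f_def by (rule g) (simp add: slit_plane_iff y)
      from field_vector_diff_chain_at[OF line this] show ?thesis by (simp add: o_def)
    qed
  qed
qed

text \<open>A natural exponent \<open>k\<close> stands for \<open>n + 1\<close>, so that the index
  -1, at which the Casoratian is evaluated, is the legitimate value \<open>k = 0\<close>.\<close>

definition hankel_integral :: "real \<Rightarrow> real \<Rightarrow> complex \<Rightarrow> nat \<Rightarrow> real \<Rightarrow> complex" where
  "hankel_integral \<epsilon> \<rho> \<theta> k R =
     contour_integral (hankel_path \<epsilon> R) (\<lambda>z. exp (of_real \<rho> * z) / (z ^ k * (z - 1) powr \<theta>))"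

lemma holomorphic_on_hankel_integrand:
  "(\<lambda>z. exp (of_real \<rho> * z) / (z ^ k * (z - 1) powr \<theta>)) holomorphic_on slit_plane"
proof -
  have "z \<noteq> 0" "z \<noteq> 1" if "z \<in> slit_plane" for z
    using that by (auto simp: slit_plane_iff)
  then show ?thesis
    by (intro holomorphic_intros holomorphic_on_powr_slit_plane) auto
qed

lemma hankel_integral_converges:
  assumes "\<rho> > 0" "\<epsilon> > 0"
  shows "\<exists>l. (hankel_integral \<epsilon> \<rho> \<theta> k \<longlongrightarrow> l) at_top"
proof -
  obtain g where g: "\<And>z. z \<in> slit_plane \<Longrightarrow>
      (g has_field_derivative exp (of_real \<rho> * z) / (z ^ k * (z - 1) powr \<theta>)) (at z)"
    using slit_plane_primitive[OF holomorphic_on_hankel_integrand] by blast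
  have "hankel_integral \<epsilon> \<rho> \<theta> k = (\<lambda>R. g (Complex (- R) \<epsilon>) - g (Complex (- R) (- \<epsilon>)))"
    unfolding hankel_integral_def
    using contour_integral_unique[OF has_contour_integral_hankel_path[OF assms(2) g]] by auto
  then show ?thesis
    using hankel_ray_converges[OF assms(1) _ g, of \<epsilon>] hankel_ray_converges[OF assms(1) _ g, of "- \<epsilon>"] assms(2)
    by (auto intro: tendsto_diff)
qed

lemma has_contour_integral_linear3:
  assumes "f contour_integrable_on \<gamma>" "g contour_integrable_on \<gamma>" "h contour_integrable_on \<gamma>"
  shows "((\<lambda>z. a * f z - b * g z + c * h z) has_contour_integral
    a * contour_integral \<gamma> f - b * contour_integral \<gamma> g + c * contour_integral \<gamma> h) \<gamma>"
  using assms by (intro has_contour_integral_add has_contour_integral_diff has_contour_integral_lmul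
      has_contour_integral_integral)

lemma hankel_integral_recurrence:
  fixes \<theta> :: complex
  assumes \<rho>: "\<rho> > 0" and \<epsilon>: "\<epsilon> > 0"
  shows "((\<lambda>R. of_real \<rho> * hankel_integral \<epsilon> \<rho> \<theta> k R
      - (of_real \<rho> + \<theta> + of_nat k) * hankel_integral \<epsilon> \<rho> \<theta> (Suc k) R
      + of_nat (Suc k) * hankel_integral \<epsilon> \<rho> \<theta> (Suc (Suc k)) R) \<longlongrightarrow> 0) at_top"
proof -
  define \<phi> where "\<phi> k z = exp (of_real \<rho> * z) / (z ^ k * (z - 1) powr \<theta>)" for k z
  \<comment> \<open>The power is taken one higher than in the integrand: differentiating it gives
    back exponent \<open>- \<theta>\<close>, and in the other two terms the spare factor
    \<open>z - 1\<close> is expanded, shifting \<open>k\<close> by one. This yields exactly the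
    three consecutive integrands.\<close>
  define A where "A z = exp (of_real \<rho> * z) * (z - 1) powr (1 - \<theta>) / z ^ Suc k" for z
  have deriv: "(A has_field_derivative of_real \<rho> * \<phi> k z - (of_real \<rho> + \<theta> + of_nat k) * \<phi> (Suc k) z
      + of_nat (Suc k) * \<phi> (Suc (Suc k)) z) (at z)" if "z \<in> slit_plane" for z
  proof -
    have nz: "z \<noteq> 0" "z - 1 \<noteq> 0" using that by (auto simp: slit_plane_iff)
    define P where "P = (z - 1) powr (- \<theta>)"
    have P: "(z - 1) powr (1 - \<theta>) = (z - 1) * P" "1 / (z - 1) powr \<theta> = P"
      using nz powr_add[of "z - 1" 1 "- \<theta>"] by (simp_all add: P_def powr_minus divide_inverse)
    have \<phi>: "\<phi> l z = exp (of_real \<rho> * z) * P / z ^ l" for l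
      by (simp add: \<phi>_def P(2)[symmetric])
    have powr': "((\<lambda>z. (z - 1) powr (1 - \<theta>)) has_field_derivative (1 - \<theta>) * P) (at z)"
      using has_field_derivative_powr_slit_plane[OF that, of "1 - \<theta>"] by (simp add: P_def)
    have e': "((\<lambda>z. exp (of_real \<rho> * z)) has_field_derivative of_real \<rho> * exp (of_real \<rho> * z)) (at z)"
      by (auto intro!: derivative_eq_intros)
    have pow': "((\<lambda>z. z ^ Suc k) has_field_derivative of_nat (Suc k) * z ^ k) (at z)"
      by (rule derivative_eq_intros refl | simp)+
    have "(A has_field_derivative
       ((of_real \<rho> * exp (of_real \<rho> * z) * (z - 1) powr (1 - \<theta>) + (1 - \<theta>) * P * exp (of_real \<rho> * z)) * z ^ Suc k
        - exp (of_real \<rho> * z) * (z - 1) powr (1 - \<theta>) * (of_nat (Suc k) * z ^ k)) / (z ^ Suc k * z ^ Suc k)) (at z)"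
      unfolding A_def
      by (rule DERIV_divide[OF DERIV_mult[OF e' powr'] pow']) (use nz in simp)
    also have "((of_real \<rho> * exp (of_real \<rho> * z) * (z - 1) powr (1 - \<theta>) + (1 - \<theta>) * P * exp (of_real \<rho> * z)) * z ^ Suc k
        - exp (of_real \<rho> * z) * (z - 1) powr (1 - \<theta>) * (of_nat (Suc k) * z ^ k)) / (z ^ Suc k * z ^ Suc k)
      = of_real \<rho> * \<phi> k z - (of_real \<rho> + \<theta> + of_nat k) * \<phi> (Suc k) z
      + of_nat (Suc k) * \<phi> (Suc (Suc k)) z"
      unfolding \<phi> P(1) using nz by (simp add: divide_simps) (simp add: algebra_simps)
    finally show ?thesis .
  qed
  have int: "\<phi> l contour_integrable_on (hankel_path \<epsilon> R)" for l R
    unfolding \<phi>_def by (rule contour_integrable_hankel_path[OF \<epsilon> holomorphic_on_hankel_integrand])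
  have eq: "of_real \<rho> * hankel_integral \<epsilon> \<rho> \<theta> k R
      - (of_real \<rho> + \<theta> + of_nat k) * hankel_integral \<epsilon> \<rho> \<theta> (Suc k) R
      + of_nat (Suc k) * hankel_integral \<epsilon> \<rho> \<theta> (Suc (Suc k)) R
      = A (Complex (- R) \<epsilon>) - A (Complex (- R) (- \<epsilon>))" for R
    unfolding hankel_integral_def \<phi>_def[symmetric]
    by (rule has_contour_integral_unique[OF has_contour_integral_linear3[OF int int int]
        has_contour_integral_hankel_path[OF \<epsilon> deriv]])
  have "((\<lambda>R. A (Complex (- R) y)) \<longlongrightarrow> 0) at_top" for y
  proof (rule Lim_null_comparison)
    show "((\<lambda>R. norm (exp (of_real \<rho> * Complex (- R) y) * (Complex (- R) y - 1) powr (1 - \<theta>))) \<longlongrightarrow> 0) at_top"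
      by (rule tendsto_norm_zero[OF hankel_end_tendsto_0[OF \<rho>]])
    show "\<forall>\<^sub>F R in at_top. norm (A (Complex (- R) y)) \<le>
        norm (exp (of_real \<rho> * Complex (- R) y) * (Complex (- R) y - 1) powr (1 - \<theta>))"
      using eventually_ge_at_top[of 1]
    proof eventually_elim
      case (elim R)
      have "norm (Complex (- R) y) \<ge> 1" using abs_Re_le_cmod[of "Complex (- R) y"] elim by simp
      then have "1 \<le> norm (Complex (- R) y) ^ Suc k" by (rule one_le_power)
      then show ?case
        unfolding A_def norm_divide norm_power by (intro divide_le_eq[THEN iffD2]) 
          (auto intro!: mult_left_mono[of 1 _ "norm _", simplified] simp del: power_Suc)
    qed
  qed
  from tendsto_diff[OF this[of \<epsilon>] this[of "- \<epsilon>"]] show ?thesis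
    unfolding eq by simp
qed

section \<open>Hankel's integral for the reciprocal Gamma function\<close>

text \<open>The integral over an unbounded set is a limit over all boxes containing a large ball;
  the symmetric box from \<open>- T\<close> to \<open>T\<close> meets the half-line in
  \<open>{0..T}\<close>.\<close>

lemma has_integral_Ici_imp_tendsto:
  fixes f :: "real \<Rightarrow> complex"
  assumes "(f has_integral I) {0..}"
  shows "((\<lambda>T. integral {0..T} f) \<longlongrightarrow> I) at_top"
proof (rule tendstoI)
  fix e :: real assume e: "e > 0"
  \<comment> \<open>The characterisation by large boxes applies only to sets that are not boxes
    themselves.\<close>
  have "\<not> (\<exists>a b. {0::real..} = cbox a b)"
  proof
    assume "\<exists>a b. {0::real..} = cbox a b"
    then obtain a b where ab: "{0::real..} = {a..b}" by auto
    have "max 0 b + 1 \<in> {0::real..}" by simp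
    then have "max 0 b + 1 \<le> b" unfolding ab by simp
    then show False using max.cobounded2[of b 0] by linarith
  qed
  from has_integral_altD[OF assms this e] obtain B where B: "B > 0"
    "\<And>a b. ball 0 B \<subseteq> cbox a b \<Longrightarrow>
      \<exists>z. ((\<lambda>x. if x \<in> {0..} then f x else 0) has_integral z) (cbox a b) \<and> norm (z - I) < e"
    by blast
  show "\<forall>\<^sub>F T in at_top. dist (integral {0..T} f) I < e"
    using eventually_ge_at_top[of B]
  proof eventually_elim
    case (elim T)
    have "ball 0 B \<subseteq> cbox (- T) T"
      using elim by (auto simp: dist_real_def)
    from B(2)[OF this] obtain z where z:
      "((\<lambda>x. if x \<in> {0..} then f x else 0) has_integral z) (cbox (- T) T)" "norm (z - I) < e"
      by blast
    have "{0..} \<inter> cbox (- T) T = {0..T}" using elim B(1) by auto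
    then have "(f has_integral z) {0..T}"
      using z(1) by (simp only: has_integral_restrict_Int)
    then show ?case using z(2) by (simp add: integral_unique dist_norm)
  qed
qed

text \<open>On the negative axis the principal argument is \<open>pi\<close>, so the value on the
  cut is the boundary value from above.\<close>

lemma powr_negative_real:
  fixes a :: complex
  assumes "s \<ge> 0"
  shows "(- complex_of_real s) powr a = exp (\<i> * of_real pi * a) * of_real s powr a"
proof (cases "s = 0")
  case False
  then have "Ln (- complex_of_real s) = Ln (of_real s) + \<i> * of_real pi"
    using assms by (subst Ln_minus) auto
  then show ?thesis using False by (simp add: powr_def exp_add[symmetric] algebra_simps)
qed simp

text \<open>Rotating by \<open>- \<i>\<close> maps the closed upper half-plane to the closed right
  half-plane, away from the cut. The rotated form shows continuity up to the real axis, which the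
  original hides.\<close>

lemma powr_upper_half_plane:
  fixes w a :: complex
  assumes "Im w \<ge> 0"
  shows "w powr a = exp (\<i> * of_real pi / 2 * a) * (- \<i> * w) powr a"
proof (cases "w = 0")
  case False
  have "Ln w = Ln (- \<i> * w) + \<i> * of_real pi / 2"
    using Ln_times_ii[of "- \<i> * w"] False assms by simp
  then show ?thesis using False by (simp add: powr_def exp_add[symmetric] algebra_simps)
qed simp

text \<open>For \<open>Re a > 0\<close> the integrand is continuous on the closed upper half-plane, branch point
  included, so it has a primitive there and the ray can be pushed onto the cut, where the integral is
  Euler's integral for \<open>Gamma\<close>.\<close>

lemma hankel_ray_tendsto:
  fixes a :: complex and \<rho> \<epsilon> :: real
  assumes \<rho>: "\<rho> > 0" and \<epsilon>: "\<epsilon> > 0" and a: "Re a > 0"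
  defines "f \<equiv> \<lambda>z. exp (of_real \<rho> * z) * (z - 1) powr a"
  shows "((\<lambda>R. contour_integral (linepath 2 (Complex (- R) \<epsilon>)) f) \<longlongrightarrow>
    - (exp (\<i> * of_real pi * a) * exp (of_real \<rho>) * Gamma (a + 1) / of_real \<rho> powr (a + 1))
    - contour_integral (linepath 1 2) f) at_top"
proof -
  define S where "S = {z. Im z \<ge> 0}"
  have S: "convex S" unfolding S_def by (rule convex_halfspace_Im_ge)
  have f_alt: "f z = exp (of_real \<rho> * z) * (exp (\<i> * of_real pi / 2 * a) * (- \<i> * (z - 1)) powr a)"
    if "z \<in> S" for z
    using powr_upper_half_plane[of "z - 1" a] that by (simp add: f_def S_def)
  have "continuous_on S (\<lambda>z. exp (of_real \<rho> * z) * (exp (\<i> * of_real pi / 2 * a) * (- \<i> * (z - 1)) powr a))"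
    by (intro continuous_intros) (auto simp: S_def a)
  then have cont: "continuous_on S f"
    by (simp add: f_alt cong: continuous_on_cong)
  have int_S: "Im x > 0" if "x \<in> interior S" for x
  proof -
    from that obtain e where e: "e > 0" "ball x e \<subseteq> S" by (auto simp: mem_interior)
    have "x - \<i> * of_real (e / 2) \<in> ball x e" using e(1) by (simp add: dist_norm norm_mult)
    with e(2) have "x - \<i> * of_real (e / 2) \<in> S" by blast
    then show ?thesis using e(1) by (simp add: S_def)
  qed
  obtain g where g: "\<And>z. z \<in> S \<Longrightarrow> (g has_field_derivative f z) (at z within S)"
  proof (rule holomorphic_convex_primitive[OF S finite.emptyI cont])
    fix x assume "x \<in> interior S - {}"
    then have "x \<in> slit_plane" using int_S by (force simp: slit_plane_iff)
    moreover have "f holomorphic_on slit_plane"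
      unfolding f_def by (intro holomorphic_intros holomorphic_on_powr_slit_plane)
    ultimately show "f field_differentiable at x"
      using open_slit_plane holomorphic_on_imp_differentiable_at by blast
  qed blast
  have seg: "(f has_contour_integral g q - g p) (linepath p q)" if "p \<in> S" "q \<in> S" for p q
  proof -
    have "closed_segment p q \<subseteq> S" by (rule closed_segment_subset[OF that S])
    then show ?thesis using contour_integral_primitive[OF g, of "linepath p q"] by simp
  qed
  have p1: "of_real x \<in> S" "1 \<in> S" "2 \<in> S" "Complex x \<epsilon> \<in> S" for x
    using \<epsilon> by (simp_all add: S_def)
  \<comment> \<open>The phase is the boundary value of the power on the cut,
    \<open>exp \<rho>\<close> comes from placing the origin of the ray at 1, and the power of \<rho>
    from rescaling to Euler's integral.\<close>
  define c where "c = exp (\<i> * of_real pi * a) * exp (of_real \<rho>) / of_real \<rho> powr (a + 1)"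
  define h where "h t = complex_of_real t powr (a + 1 - 1) / of_real (exp t)" for t :: real
  have real_part: "g (of_real (- R)) - g 1 = - c * integral {0..\<rho> * (R + 1)} h" if "R \<ge> 0" for R
  proof -
    \<comment> \<open>The substitution \<open>t = \<rho> * (1 - x)\<close> runs along the cut
      leftwards from the branch point 1, and \<open>x = - R\<close> corresponds to
      \<open>t = \<rho> * (R + 1)\<close>.\<close>
    define \<gamma> where "\<gamma> t = 1 - complex_of_real t / of_real \<rho>" for t :: real
    define T where "T = \<rho> * (R + 1)"
    have T: "T \<ge> 0" using \<rho> that by (simp add: T_def)
    have deriv: "((g \<circ> \<gamma>) has_vector_derivative - c * h t) (at t within {0..T})" if "t \<in> {0..T}" for t
    proof -
      have "(\<gamma> has_vector_derivative - 1 / of_real \<rho>) (at t within {0..T})"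
        unfolding \<gamma>_def by (auto intro!: derivative_eq_intros)
      moreover have "(g has_field_derivative f (\<gamma> t)) (at (\<gamma> t) within \<gamma> ` {0..T})"
        by (rule has_field_derivative_subset[OF g]) (auto simp: \<gamma>_def S_def)
      ultimately have "((g \<circ> \<gamma>) has_vector_derivative (- 1 / of_real \<rho>) * f (\<gamma> t)) (at t within {0..T})"
        by (rule field_vector_diff_chain_within)
      also have "(- 1 / of_real \<rho>) * f (\<gamma> t) = - c * h t"
      proof -
        have "(\<gamma> t - 1) powr a = exp (\<i> * of_real pi * a) * of_real (t / \<rho>) powr a"
          using powr_negative_real[of "t / \<rho>" a] that \<rho> by (simp add: \<gamma>_def)
        also have "of_real (t / \<rho>) powr a = of_real t powr a / of_real \<rho> powr a"
          using that \<rho> powr_times_real[of "of_real (t / \<rho>)" "of_real \<rho>" a] by (simp add: field_simps)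
        finally have 1: "(\<gamma> t - 1) powr a = exp (\<i> * of_real pi * a) * (of_real t powr a / of_real \<rho> powr a)" .
        have 2: "exp (of_real \<rho> * \<gamma> t) = exp (of_real \<rho>) / of_real (exp t)"
          using \<rho> by (simp add: \<gamma>_def right_diff_distrib exp_diff exp_of_real)
        have 3: "complex_of_real \<rho> powr (a + 1) = of_real \<rho> powr a * of_real \<rho>"
          using \<rho> by (simp add: powr_add)
        show ?thesis unfolding f_def 1 2 c_def h_def 3 using \<rho> by (simp add: field_simps)
      qed
      finally show ?thesis .
    qed
    have "((\<lambda>t. - c * h t) has_integral (g \<circ> \<gamma>) T - (g \<circ> \<gamma>) 0) {0..T}"
      by (rule fundamental_theorem_of_calculus[OF T deriv])
    then have "integral {0..T} (\<lambda>t. - c * h t) = (g \<circ> \<gamma>) T - (g \<circ> \<gamma>) 0"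
      by (rule integral_unique)
    moreover have "\<gamma> T = of_real (- R)" "\<gamma> 0 = 1"
      using \<rho> by (simp_all add: \<gamma>_def T_def field_simps)
    ultimately show ?thesis by (simp add: T_def)
  qed
  have "(h has_integral Gamma (a + 1)) {0..}"
    unfolding h_def by (rule Gamma_integral_complex) (use a in simp)
  then have "((\<lambda>T. integral {0..T} h) \<longlongrightarrow> Gamma (a + 1)) at_top"
    by (rule has_integral_Ici_imp_tendsto)
  moreover have "filterlim (\<lambda>R. \<rho> * (R + 1)) at_top at_top"
    using \<rho> by real_asymp
  ultimately have "((\<lambda>R. integral {0..\<rho> * (R + 1)} h) \<longlongrightarrow> Gamma (a + 1)) at_top"
    by (rule filterlim_compose)
  then have "((\<lambda>R. - c * integral {0..\<rho> * (R + 1)} h) \<longlongrightarrow> - c * Gamma (a + 1)) at_top"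
    by (intro tendsto_intros)
  then have lim_real: "((\<lambda>R. g (of_real (- R)) - g 1) \<longlongrightarrow> - c * Gamma (a + 1)) at_top"
    by (rule Lim_transform_eventually)
      (rule eventually_mono[OF eventually_ge_at_top[of 0] real_part[symmetric]])
  \<comment> \<open>The vertical segment joining the cut to the ray has fixed length \<epsilon>,
    while the integrand on it decays exponentially in \<open>R\<close>.\<close>
  have lim_vert: "((\<lambda>R. g (Complex (- R) \<epsilon>) - g (of_real (- R))) \<longlongrightarrow> 0) at_top"
  proof (rule Lim_null_comparison)
    show "((\<lambda>R. exp (- \<rho> * R) * (R + 1 + \<epsilon>) powr \<bar>Re a\<bar> * (exp (pi * \<bar>Im a\<bar>) * \<epsilon>)) \<longlongrightarrow> 0) at_top"
      by (rule hankel_bound_tendsto_0[OF \<rho>])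
    show "\<forall>\<^sub>F R in at_top. norm (g (Complex (- R) \<epsilon>) - g (of_real (- R))) \<le>
        exp (- \<rho> * R) * (R + 1 + \<epsilon>) powr \<bar>Re a\<bar> * (exp (pi * \<bar>Im a\<bar>) * \<epsilon>)"
      using eventually_ge_at_top[of 0]
    proof eventually_elim
      case (elim R)
      have "norm (g (Complex (- R) \<epsilon>) - g (of_real (- R))) \<le>
        (exp (- \<rho> * R) * (R + 1 + \<epsilon>) powr \<bar>Re a\<bar> * exp (pi * \<bar>Im a\<bar>))
         * norm (Complex (- R) \<epsilon> - of_real (- R))"
      proof (rule has_contour_integral_bound_linepath[OF seg])
        fix z assume "z \<in> closed_segment (complex_of_real (- R)) (Complex (- R) \<epsilon>)"
        then have "Re z = - R" "Im z \<in> {0..\<epsilon>}"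
          using \<epsilon> by (auto simp: closed_segment_same_Re closed_segment_eq_real_ivl)
        then have "z = Complex (- R) (Im z)" "\<bar>Im z\<bar> \<le> \<epsilon>" by (auto simp: complex_eq_iff)
        then show "norm (f z) \<le> exp (- \<rho> * R) * (R + 1 + \<epsilon>) powr \<bar>Re a\<bar> * exp (pi * \<bar>Im a\<bar>)"
          unfolding f_def using norm_hankel_integrand_le[OF elim, of "Im z" \<epsilon> \<rho> a] by metis
      qed (auto intro!: p1 simp del: of_real_minus)
      also have "norm (Complex (- R) \<epsilon> - of_real (- R)) = \<epsilon>"
        using \<epsilon> by (simp add: cmod_def)
      finally show ?case by (simp add: mult_ac)
    qed
  qed
  have "contour_integral (linepath 2 (Complex (- R) \<epsilon>)) f =
      (g (Complex (- R) \<epsilon>) - g (of_real (- R))) + (g (of_real (- R)) - g 1)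
      - contour_integral (linepath 1 2) f" for R
    using contour_integral_unique[OF seg[OF p1(3) p1(4)[of "- R"]]]
      contour_integral_unique[OF seg[OF p1(2) p1(3)]] by simp
  moreover have "((\<lambda>R. (g (Complex (- R) \<epsilon>) - g (of_real (- R))) + (g (of_real (- R)) - g 1)
      - contour_integral (linepath 1 2) f) \<longlongrightarrow>
      0 + - c * Gamma (a + 1) - contour_integral (linepath 1 2) f) at_top"
    by (intro tendsto_intros lim_vert lim_real)
  ultimately show ?thesis by (simp add: c_def)
qed

lemma cnj_powr_real:
  fixes a :: complex
  assumes "\<rho> > 0"
  shows "cnj (of_real \<rho> powr a) = of_real \<rho> powr cnj a"
  using assms by (subst cnj_powr) auto

text \<open>The two banks of the cut carry the same Euler integral with phases
  \<open>exp (\<i> * pi * a)\<close> and its inverse, where \<open>a = - \<theta>\<close>; their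
  difference is a sine, and the reflection formula turns sine times Gamma into
  \<open>rGamma \<theta>\<close>. The lower bank is the conjugate of the upper one for the conjugate
  exponent.\<close>

lemma hankel_integral_0_tendsto_Re_neg:
  fixes \<theta> :: complex and \<rho> \<epsilon> :: real
  assumes \<rho>: "\<rho> > 0" and \<epsilon>: "\<epsilon> > 0" and \<theta>: "Re \<theta> < 0"
  shows "(hankel_integral \<epsilon> \<rho> \<theta> 0 \<longlongrightarrow>
    2 * of_real pi * \<i> * (of_real \<rho> powr (\<theta> - 1) * exp (of_real \<rho>) * rGamma \<theta>)) at_top"
proof -
  define a where "a = - \<theta>"
  have a: "Re a > 0" using \<theta> by (simp add: a_def)
  define f where "f b z = exp (of_real \<rho> * z) * (z - 1) powr b" for b z :: complex
  define J where "J b = contour_integral (linepath 1 2) (f b)" for b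
  define K where "K b = exp (of_real \<rho>) * Gamma (b + 1) / of_real \<rho> powr (b + 1)" for b :: complex
  \<comment> \<open>Conjugation commutes with the principal power only off the cut, hence the
    restriction on real \<open>z\<close>.\<close>
  have f_cnj: "(cnj \<circ> f b \<circ> cnj) z = f (cnj b) z" if "Im z = 0 \<Longrightarrow> Re z \<ge> 1" for b z
  proof -
    have "cnj ((cnj z - 1) powr b) = (z - 1) powr cnj b"
      using that by (subst cnj_powr) auto
    then show ?thesis by (simp add: f_def exp_cnj)
  qed
  have "((\<lambda>R. contour_integral (linepath 2 (Complex (- R) \<epsilon>)) (f b)) \<longlongrightarrow>
      - (exp (\<i> * of_real pi * b) * K b) - J b) at_top" if "Re b > 0" for b
    using hankel_ray_tendsto[OF \<rho> \<epsilon> that] by (simp add: f_def[abs_def] J_def K_def mult_ac)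
  note upper = this
  have lower: "((\<lambda>R. contour_integral (linepath 2 (Complex (- R) (- \<epsilon>))) (f a)) \<longlongrightarrow>
      - (exp (- (\<i> * of_real pi * a)) * K a) - J a) at_top"
  proof -
    have cnj_path: "cnj \<circ> linepath 2 (Complex (- R) \<epsilon>) = linepath 2 (Complex (- R) (- \<epsilon>))" for R
      by (simp add: linepath_cnj' complex_cnj)
    have "contour_integral (linepath 2 (Complex (- R) (- \<epsilon>))) (f a)
        = cnj (contour_integral (linepath 2 (Complex (- R) \<epsilon>)) (f (cnj a)))" for R
    proof -
      have "contour_integral (linepath 2 (Complex (- R) (- \<epsilon>))) (f a)
        = cnj (contour_integral (linepath 2 (Complex (- R) \<epsilon>)) (cnj \<circ> f a \<circ> cnj))"
        unfolding cnj_path[symmetric] by (rule contour_integral_cnj) simp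
      also have "contour_integral (linepath 2 (Complex (- R) \<epsilon>)) (cnj \<circ> f a \<circ> cnj)
        = contour_integral (linepath 2 (Complex (- R) \<epsilon>)) (f (cnj a))"
      proof (rule contour_integral_eq)
        fix z assume "z \<in> path_image (linepath 2 (Complex (- R) \<epsilon>))"
        then obtain u where u: "0 \<le> u" "u \<le> 1" "z = (1 - u) *\<^sub>R 2 + u *\<^sub>R Complex (- R) \<epsilon>"
          by (auto simp: closed_segment_def)
        then have "Im z = 0 \<Longrightarrow> z = 2" using \<epsilon> by simp
        then show "(cnj \<circ> f a \<circ> cnj) z = f (cnj a) z" by (intro f_cnj) auto
      qed
      finally show ?thesis .
    qed
    moreover have "J a = cnj (J (cnj a))"
    proof -
      have "J a = contour_integral (cnj \<circ> linepath 1 2) (f a)"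
        by (simp add: J_def linepath_cnj')
      also have "\<dots> = cnj (contour_integral (linepath 1 2) (cnj \<circ> f a \<circ> cnj))"
        by (rule contour_integral_cnj) simp
      also have "contour_integral (linepath 1 2) (cnj \<circ> f a \<circ> cnj) = J (cnj a)"
        unfolding J_def
      proof (rule contour_integral_eq)
        fix z :: complex assume "z \<in> path_image (linepath 1 2)"
        then have "Re z \<ge> 1" by (auto simp: closed_segment_def)
        then show "(cnj \<circ> f a \<circ> cnj) z = f (cnj a) z" by (intro f_cnj) auto
      qed
      finally show ?thesis .
    qed
    moreover have "K a = cnj (K (cnj a))"
      using \<rho> by (simp add: K_def exp_cnj cnj_Gamma cnj_powr_real)
    ultimately show ?thesis
      using tendsto_cnj[OF upper[of "cnj a"]] a by (simp add: exp_cnj)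
  qed
  obtain g where g: "\<And>z. z \<in> slit_plane \<Longrightarrow> (g has_field_derivative f a z) (at z)"
  proof (rule slit_plane_primitive)
    show "f a holomorphic_on slit_plane"
      unfolding f_def by (intro holomorphic_intros holomorphic_on_powr_slit_plane)
  qed blast
  \<comment> \<open>The point 2 lies to the right of the cut, so the segments from it to both ends
    stay in \<open>slit_plane\<close> and the Hankel integral is the upper one minus the lower one.
    The contribution \<open>J a\<close> between 1 and 2 cancels in that difference.\<close>
  have ray: "contour_integral (linepath 2 (Complex (- R) y)) (f a) = g (Complex (- R) y) - g 2"
    if "y \<noteq> 0" for R y
  proof -
    have "path_image (linepath 2 (Complex (- R) y)) \<subseteq> slit_plane"
    proof
      fix z assume "z \<in> path_image (linepath 2 (Complex (- R) y))"
      then obtain u where u: "0 \<le> u" "u \<le> 1" "z = (1 - u) *\<^sub>R 2 + u *\<^sub>R Complex (- R) y"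
        by (auto simp: closed_segment_def)
      show "z \<in> slit_plane"
        using u that by (cases "u = 0") (auto simp: slit_plane_iff)
    qed
    from contour_integral_primitive[OF _ _ this, of g "f a"] show ?thesis
      using g by (intro contour_integral_unique) (simp add: has_field_derivative_at_within)
  qed
  have "hankel_integral \<epsilon> \<rho> \<theta> 0 R = contour_integral (hankel_path \<epsilon> R) (f a)" for R
    unfolding hankel_integral_def f_def a_def
    by (intro contour_integral_eq) (simp add: powr_minus divide_inverse)
  also have "\<dots> R = contour_integral (linepath 2 (Complex (- R) \<epsilon>)) (f a)
      - contour_integral (linepath 2 (Complex (- R) (- \<epsilon>))) (f a)" for R
    using ray[of \<epsilon> R] ray[of "- \<epsilon>" R] \<epsilon>
      contour_integral_unique[OF has_contour_integral_hankel_path[OF \<epsilon> g]] by simp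
  finally have "hankel_integral \<epsilon> \<rho> \<theta> 0 = (\<lambda>R. contour_integral (linepath 2 (Complex (- R) \<epsilon>)) (f a)
      - contour_integral (linepath 2 (Complex (- R) (- \<epsilon>))) (f a))" by (rule ext)
  moreover have "((\<lambda>R. contour_integral (linepath 2 (Complex (- R) \<epsilon>)) (f a)
      - contour_integral (linepath 2 (Complex (- R) (- \<epsilon>))) (f a)) \<longlongrightarrow>
      (- (exp (\<i> * of_real pi * a) * K a) - J a)
      - (- (exp (- (\<i> * of_real pi * a)) * K a) - J a)) at_top"
    by (intro tendsto_diff lower upper a)
  moreover have "(- (exp (\<i> * of_real pi * a) * K a) - J a)
      - (- (exp (- (\<i> * of_real pi * a)) * K a) - J a)
      = 2 * of_real pi * \<i> * (of_real \<rho> powr (\<theta> - 1) * exp (of_real \<rho>) * rGamma \<theta>)"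
  proof -
    have an: "a \<notin> \<int>\<^sub>\<le>\<^sub>0" using a by (auto elim!: nonpos_Ints_cases')
    have "a \<noteq> 0" using a by auto
    have "rGamma a * rGamma \<theta> = - a * sin (of_real pi * a) / of_real pi"
      using rGamma_reflection_complex'[of a] by (simp add: a_def)
    moreover have "Gamma (a + 1) = a * Gamma a" using an by (rule Gamma_plus1)
    moreover have "Gamma a * rGamma a = 1" using an by (simp add: Gamma_def rGamma_eq_zero_iff)
    ultimately have rG: "rGamma \<theta> = - (sin (of_real pi * a) * Gamma (a + 1) / of_real pi)"
    proof -
      assume 1: "rGamma a * rGamma \<theta> = - a * sin (of_real pi * a) / of_real pi"
        and 2: "Gamma (a + 1) = a * Gamma a" and 3: "Gamma a * rGamma a = 1"
      have "rGamma \<theta> = (Gamma a * rGamma a) * rGamma \<theta>" by (simp add: 3)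
      also have "\<dots> = Gamma a * (- a * sin (of_real pi * a) / of_real pi)"
        by (simp only: mult.assoc 1)
      finally show ?thesis by (simp add: 2 mult_ac)
    qed
    define \<sigma> where "\<sigma> = sin (of_real pi * a)"
    define G where "G = Gamma (a + 1)"
    define Q where "Q = complex_of_real \<rho> powr (a + 1)"
    have Q: "of_real \<rho> powr (\<theta> - 1) = 1 / Q"
      by (simp add: Q_def a_def powr_minus[symmetric] divide_inverse)
    have sin: "exp (\<i> * of_real pi * a) - exp (- (\<i> * of_real pi * a)) = 2 * \<i> * \<sigma>"
      by (simp add: \<sigma>_def sin_exp_eq mult_ac)
    have "(- (exp (\<i> * of_real pi * a) * K a) - J a) - (- (exp (- (\<i> * of_real pi * a)) * K a) - J a)
        = - ((exp (\<i> * of_real pi * a) - exp (- (\<i> * of_real pi * a))) * K a)"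
      by (simp add: algebra_simps)
    also have "\<dots> = - (2 * \<i> * \<sigma> * (exp (of_real \<rho>) * G / Q))"
      unfolding sin K_def G_def Q_def by simp
    also have "\<dots> = 2 * of_real pi * \<i> * (of_real \<rho> powr (\<theta> - 1) * exp (of_real \<rho>) * rGamma \<theta>)"
      unfolding rG Q \<sigma>_def[symmetric] G_def[symmetric] by (simp add: mult_ac)
    finally show ?thesis .
  qed
  ultimately show ?thesis by simp
qed

text \<open>Integration by parts: the derivative of
  \<open>exp (\<rho> * z) * (z - 1) powr (- \<theta>)\<close> links the exponents \<theta> and
  \<open>\<theta> + 1\<close>, and its end values vanish in the limit. This mirrors the functional
  equation of \<open>rGamma\<close>.\<close>

lemma hankel_integral_0_step:
  fixes \<theta> L :: complex and \<rho> \<epsilon> :: real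
  assumes \<rho>: "\<rho> > 0" and \<epsilon>: "\<epsilon> > 0" and "\<theta> \<noteq> 0"
    and lim: "(hankel_integral \<epsilon> \<rho> \<theta> 0 \<longlongrightarrow> L) at_top"
  shows "(hankel_integral \<epsilon> \<rho> (\<theta> + 1) 0 \<longlongrightarrow> of_real \<rho> * L / \<theta>) at_top"
proof -
  define A where "A z = exp (of_real \<rho> * z) * (z - 1) powr (- \<theta>)" for z
  define \<phi> where "\<phi> t z = exp (of_real \<rho> * z) / (z ^ 0 * (z - 1) powr t)" for t z :: complex
  have int: "\<phi> t contour_integrable_on (hankel_path \<epsilon> R)" for t R
    unfolding \<phi>_def by (rule contour_integrable_hankel_path[OF \<epsilon> holomorphic_on_hankel_integrand])
  have deriv: "(A has_field_derivative of_real \<rho> * \<phi> \<theta> z - \<theta> * \<phi> (\<theta> + 1) z) (at z)"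
    if "z \<in> slit_plane" for z
  proof -
    have "((\<lambda>z. exp (of_real \<rho> * z)) has_field_derivative of_real \<rho> * exp (of_real \<rho> * z)) (at z)"
      by (auto intro!: derivative_eq_intros)
    from DERIV_mult[OF this has_field_derivative_powr_slit_plane[OF that, of "- \<theta>"]]
    have "(A has_field_derivative of_real \<rho> * exp (of_real \<rho> * z) * (z - 1) powr (- \<theta>)
        + - \<theta> * (z - 1) powr (- \<theta> - 1) * exp (of_real \<rho> * z)) (at z)"
      by (simp add: A_def[abs_def])
    also have "(z - 1) powr (- \<theta> - 1) = (z - 1) powr (- (\<theta> + 1))" by simp
    finally show ?thesis
      unfolding \<phi>_def powr_minus by (simp add: divide_inverse mult_ac)
  qed
  have "of_real \<rho> * hankel_integral \<epsilon> \<rho> \<theta> 0 R - \<theta> * hankel_integral \<epsilon> \<rho> (\<theta> + 1) 0 R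
      = A (Complex (- R) \<epsilon>) - A (Complex (- R) (- \<epsilon>))" for R
    unfolding hankel_integral_def \<phi>_def[symmetric]
    by (rule has_contour_integral_unique[OF _ has_contour_integral_hankel_path[OF \<epsilon> deriv]],
        intro has_contour_integral_diff has_contour_integral_lmul has_contour_integral_integral int)
  then have eq: "hankel_integral \<epsilon> \<rho> (\<theta> + 1) 0 = (\<lambda>R.
      (of_real \<rho> * hankel_integral \<epsilon> \<rho> \<theta> 0 R - (A (Complex (- R) \<epsilon>) - A (Complex (- R) (- \<epsilon>)))) / \<theta>)"
    using \<open>\<theta> \<noteq> 0\<close> by (intro ext) (simp add: field_simps)
  have "((\<lambda>R. (of_real \<rho> * hankel_integral \<epsilon> \<rho> \<theta> 0 R
      - (A (Complex (- R) \<epsilon>) - A (Complex (- R) (- \<epsilon>)))) / \<theta>) \<longlongrightarrow> (of_real \<rho> * L - (0 - 0)) / \<theta>) at_top"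
    unfolding A_def by (intro tendsto_intros lim hankel_end_tendsto_0 \<rho> \<open>\<theta> \<noteq> 0\<close>)
  then show ?thesis unfolding eq by simp
qed

text \<open>At \<open>\<theta> = 1\<close> subtracting \<open>exp \<rho> / (z - 1)\<close> makes the integrand entire; the subtracted part
  contributes the jump \<open>2 * pi * \<i>\<close> of \<open>Ln\<close> across its cut.\<close>

lemma hankel_integral_0_one:
  fixes \<rho> \<epsilon> :: real
  assumes \<rho>: "\<rho> > 0" and \<epsilon>: "\<epsilon> > 0"
  shows "(hankel_integral \<epsilon> \<rho> 1 0 \<longlongrightarrow> 2 * of_real pi * \<i> * exp (of_real \<rho>)) at_top"
proof -
  \<comment> \<open>The value at 1 is the derivative of \<open>exp (\<rho> * z)\<close> there, which
    fills the removable singularity.\<close>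
  define q where "q z = (if z = 1 then of_real \<rho> * exp (of_real \<rho>)
      else (exp (of_real \<rho> * z) - exp (of_real \<rho>)) / (z - 1))" for z :: complex
  have "q holomorphic_on - {1}"
    by (rule holomorphic_transform[of "\<lambda>z. (exp (of_real \<rho> * z) - exp (of_real \<rho>)) / (z - 1)"])
      (auto intro!: holomorphic_intros simp: q_def)
  then have q_deriv: "q field_differentiable at z" if "z \<noteq> 1" for z
    using that holomorphic_on_imp_differentiable_at[of q "- {1}" z] by (simp add: open_Compl)
  have "((\<lambda>z. exp (complex_of_real \<rho> * z)) has_field_derivative of_real \<rho> * exp (of_real \<rho> * 1)) (at 1)"
    by (auto intro!: derivative_eq_intros)
  then have "((\<lambda>z. (exp (complex_of_real \<rho> * z) - exp (of_real \<rho>)) / (z - 1)) \<longlongrightarrow> of_real \<rho> * exp (of_real \<rho>)) (at 1)"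
    by (simp add: has_field_derivative_iff)
  then have "(q \<longlongrightarrow> of_real \<rho> * exp (of_real \<rho>)) (at 1)"
    by (rule Lim_transform_eventually) (auto simp: q_def eventually_at_filter)
  then have "(q \<longlongrightarrow> q 1) (at 1)" by (simp add: q_def)
  then have "isCont q z" for z
  proof (cases "z = 1")
    case False
    then show ?thesis by (intro field_differentiable_imp_continuous_at q_deriv)
  qed (use \<open>(q \<longlongrightarrow> q 1) (at 1)\<close> in \<open>simp add: isCont_def\<close>)
  then have "continuous_on UNIV q" by (simp add: continuous_on_eq_continuous_at)
  then obtain g where g: "\<And>z. (g has_field_derivative q z) (at z)"
    using holomorphic_convex_primitive[of UNIV "{1}" q] q_deriv by auto
  have deriv: "((\<lambda>z. g z + exp (of_real \<rho>) * Ln (z - 1)) has_field_derivative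
      exp (of_real \<rho> * z) / (z ^ 0 * (z - 1) powr 1)) (at z)" if "z \<in> slit_plane" for z
  proof -
    have nz: "z \<noteq> 1" "z - 1 \<notin> \<real>\<^sub>\<le>\<^sub>0"
      using that by (auto simp: slit_plane_iff complex_nonpos_Reals_iff)
    have "((\<lambda>z. Ln (z - 1)) has_field_derivative 1 / (z - 1)) (at z)"
      using nz by (auto intro!: derivative_eq_intros simp: divide_inverse)
    then have "((\<lambda>z. g z + exp (of_real \<rho>) * Ln (z - 1)) has_field_derivative
        q z + exp (of_real \<rho>) * (1 / (z - 1))) (at z)"
      by (intro DERIV_add DERIV_cmult g)
    then show ?thesis using nz by (simp add: q_def add_divide_distrib[symmetric])
  qed
  have int: "hankel_integral \<epsilon> \<rho> 1 0 R = (g (Complex (- R) \<epsilon>) - g (Complex (- R) (- \<epsilon>)))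
      + exp (of_real \<rho>) * (Ln (Complex (- R) \<epsilon> - 1) - Ln (Complex (- R) (- \<epsilon>) - 1))" for R
    unfolding hankel_integral_def
    using contour_integral_unique[OF has_contour_integral_hankel_path[OF \<epsilon> deriv]]
    by (simp add: algebra_simps)
  \<comment> \<open>As \<open>g\<close> is a primitive on the whole plane, its two end values may be
    compared across the cut, along a vertical segment of length \<open>2 * \<epsilon>\<close> where
    \<open>q\<close> is of order \<open>1 / R\<close>.\<close>
  have g_lim: "((\<lambda>R. g (Complex (- R) \<epsilon>) - g (Complex (- R) (- \<epsilon>))) \<longlongrightarrow> 0) at_top"
  proof (rule Lim_null_comparison)
    show "((\<lambda>R. 2 * exp \<rho> / (R + 1) * (2 * \<epsilon>)) \<longlongrightarrow> 0) at_top"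
      by real_asymp
    show "\<forall>\<^sub>F R in at_top. norm (g (Complex (- R) \<epsilon>) - g (Complex (- R) (- \<epsilon>))) \<le> 2 * exp \<rho> / (R + 1) * (2 * \<epsilon>)"
      using eventually_ge_at_top[of 0]
    proof eventually_elim
      case (elim R)
      have "norm (g (Complex (- R) \<epsilon>) - g (Complex (- R) (- \<epsilon>)))
          \<le> 2 * exp \<rho> / (R + 1) * norm (Complex (- R) \<epsilon> - Complex (- R) (- \<epsilon>))"
      proof (rule field_differentiable_bound[of "{z. Re z = - R}"])
        have "{z. Re z = - R} = {z. Re z \<le> - R} \<inter> {z. Re z \<ge> - R}" by auto
        then show "convex {z. Re z = - R}"
          by (simp only: convex_Int convex_halfspace_Re_le convex_halfspace_Re_ge)
        show "(g has_field_derivative q z) (at z within {z. Re z = - R})" for z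
          by (rule has_field_derivative_at_within[OF g])
        show "norm (q z) \<le> 2 * exp \<rho> / (R + 1)" if "z \<in> {z. Re z = - R}" for z
        proof -
          have "z \<noteq> 1" using that elim by auto
          have "norm (exp (of_real \<rho> * z) - exp (of_real \<rho>)) \<le> exp (- (\<rho> * R)) + exp \<rho>"
            using norm_triangle_ineq4[of "exp (of_real \<rho> * z)" "exp (of_real \<rho>)"] that by simp
          also have "\<dots> \<le> 2 * exp \<rho>"
          proof -
            have "0 \<le> \<rho> * R" using \<rho> elim by (intro mult_nonneg_nonneg) auto
            then have "- (\<rho> * R) \<le> \<rho>" using \<rho> by linarith
            then show ?thesis by simp
          qed
          finally have "norm (exp (of_real \<rho> * z) - exp (of_real \<rho>)) \<le> 2 * exp \<rho>" .
          moreover have "R + 1 \<le> norm (z - 1)"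
            using abs_Re_le_cmod[of "z - 1"] that by simp
          ultimately show ?thesis
            using \<open>z \<noteq> 1\<close> elim by (simp add: q_def norm_divide frac_le)
        qed
      qed auto
      also have "norm (Complex (- R) \<epsilon> - Complex (- R) (- \<epsilon>)) = 2 * \<epsilon>"
        using \<epsilon> by (simp add: cmod_def real_sqrt_mult)
      finally show ?case .
    qed
  qed
  \<comment> \<open>Reflection through the origin moves both points to the right half-plane, where
    \<open>Ln\<close> has no cut; the opposite signs of their imaginary parts produce the
    jump.\<close>
  have Ln_diff: "Ln (Complex (- R) \<epsilon> - 1) - Ln (Complex (- R) (- \<epsilon>) - 1) =
      2 * of_real pi * \<i> + (Ln (Complex (R + 1) (- \<epsilon>)) - Ln (Complex (R + 1) \<epsilon>))" if "R \<ge> 0" for R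
  proof -
    have neg: "Complex (- R) \<epsilon> - 1 = - Complex (R + 1) (- \<epsilon>)"
      "Complex (- R) (- \<epsilon>) - 1 = - Complex (R + 1) \<epsilon>"
      by (simp_all add: complex_eq_iff)
    have nz: "Complex (R + 1) y \<noteq> 0" for y using that by (simp add: complex_eq_iff)
    show ?thesis
      unfolding neg Ln_minus[OF nz] using \<epsilon> by simp
  qed
  have "((\<lambda>R. Ln (Complex (R + 1) (- \<epsilon>)) - Ln (Complex (R + 1) \<epsilon>)) \<longlongrightarrow> 0) at_top"
  proof (rule Lim_null_comparison)
    show "((\<lambda>R. 1 / (R + 1) * (2 * \<epsilon>)) \<longlongrightarrow> 0) at_top"
      by real_asymp
    show "\<forall>\<^sub>F R in at_top. norm (Ln (Complex (R + 1) (- \<epsilon>)) - Ln (Complex (R + 1) \<epsilon>)) \<le> 1 / (R + 1) * (2 * \<epsilon>)"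
      using eventually_ge_at_top[of 0]
    proof eventually_elim
      case (elim R)
      have "norm (Ln (Complex (R + 1) (- \<epsilon>)) - Ln (Complex (R + 1) \<epsilon>))
          \<le> 1 / (R + 1) * norm (Complex (R + 1) (- \<epsilon>) - Complex (R + 1) \<epsilon>)"
      proof (rule field_differentiable_bound[of "{z. Re z \<ge> R + 1}"])
        show "convex {z. Re z \<ge> R + 1}" by (rule convex_halfspace_Re_ge)
        show "(Ln has_field_derivative inverse z) (at z within {z. Re z \<ge> R + 1})"
          if "z \<in> {z. Re z \<ge> R + 1}" for z
          by (rule has_field_derivative_at_within, rule has_field_derivative_Ln)
            (use that elim in \<open>auto simp: complex_nonpos_Reals_iff\<close>)
        show "norm (inverse z) \<le> 1 / (R + 1)" if "z \<in> {z. Re z \<ge> R + 1}" for z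
        proof -
          have "inverse (norm z) \<le> inverse (R + 1)"
            by (rule le_imp_inverse_le) (use that elim complex_Re_le_cmod[of z] in auto)
          then show ?thesis by (simp add: norm_inverse divide_inverse)
        qed
      qed auto
      also have "norm (Complex (R + 1) (- \<epsilon>) - Complex (R + 1) \<epsilon>) = 2 * \<epsilon>"
        using \<epsilon> by (simp add: cmod_def real_sqrt_mult)
      finally show ?case .
    qed
  qed
  then have "((\<lambda>R. 2 * of_real pi * \<i> + (Ln (Complex (R + 1) (- \<epsilon>)) - Ln (Complex (R + 1) \<epsilon>)))
      \<longlongrightarrow> 2 * of_real pi * \<i> + 0) at_top"
    by (intro tendsto_intros)
  then have Ln_lim: "((\<lambda>R. Ln (Complex (- R) \<epsilon> - 1) - Ln (Complex (- R) (- \<epsilon>) - 1))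
      \<longlongrightarrow> 2 * of_real pi * \<i> + 0) at_top"
    by (rule Lim_transform_eventually)
      (rule eventually_mono[OF eventually_ge_at_top[of 0] Ln_diff[symmetric]])
  have "(hankel_integral \<epsilon> \<rho> 1 0 \<longlongrightarrow> 0 + exp (of_real \<rho>) * (2 * of_real pi * \<i> + 0)) at_top"
    unfolding int[abs_def] by (intro tendsto_intros g_lim Ln_lim)
  then show ?thesis by (simp add: mult_ac)
qed

lemma hankel_integral_0_add_nat:
  fixes \<theta> :: complex and \<rho> \<epsilon> :: real
  assumes \<rho>: "\<rho> > 0" and \<epsilon>: "\<epsilon> > 0"
    and lim: "(hankel_integral \<epsilon> \<rho> \<theta> 0 \<longlongrightarrow>
      2 * of_real pi * \<i> * (of_real \<rho> powr (\<theta> - 1) * exp (of_real \<rho>) * rGamma \<theta>)) at_top"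
    and nz: "\<And>k. k < n \<Longrightarrow> \<theta> + of_nat k \<noteq> 0"
  shows "(hankel_integral \<epsilon> \<rho> (\<theta> + of_nat n) 0 \<longlongrightarrow>
    2 * of_real pi * \<i> * (of_real \<rho> powr (\<theta> + of_nat n - 1) * exp (of_real \<rho>) * rGamma (\<theta> + of_nat n))) at_top"
  using nz
proof (induction n)
  case 0
  then show ?case using lim by simp
next
  case (Suc n)
  define t where "t = \<theta> + of_nat n"
  have t: "t \<noteq> 0" "\<theta> + of_nat (Suc n) = t + 1" using Suc.prems[of n] by (simp_all add: t_def)
  have "(hankel_integral \<epsilon> \<rho> (t + 1) 0 \<longlongrightarrow>
     of_real \<rho> * (2 * of_real pi * \<i> * (of_real \<rho> powr (t - 1) * exp (of_real \<rho>) * rGamma t)) / t) at_top"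
    by (rule hankel_integral_0_step[OF \<rho> \<epsilon> t(1)]) (use Suc in \<open>simp add: t_def\<close>)
  also have "of_real \<rho> * (2 * of_real pi * \<i> * (of_real \<rho> powr (t - 1) * exp (of_real \<rho>) * rGamma t)) / t
     = 2 * of_real pi * \<i> * ((of_real \<rho> powr (t - 1) * of_real \<rho>) * exp (of_real \<rho>) * (rGamma t / t))"
    by (simp add: mult_ac)
  also have "complex_of_real \<rho> powr (t - 1) * of_real \<rho> = of_real \<rho> powr t"
    using \<rho> powr_add[of "complex_of_real \<rho>" "t - 1" 1] by simp
  also have "rGamma t / t = rGamma (t + 1)"
    using rGamma_plus1[of t] t(1) by (simp add: field_simps)
  finally show ?case unfolding t(2) by simp
qed

text \<open>A non-integer \<theta> is lowered by a natural number to negative real part and raised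
  again without meeting 0. For a positive integer that path would divide by zero, so the ascent
  begins at 1.\<close>

theorem hankel_integral_0_tendsto:
  fixes \<theta> :: complex and \<rho> \<epsilon> :: real
  assumes \<rho>: "\<rho> > 0" and \<epsilon>: "\<epsilon> > 0" and \<theta>: "Re \<theta> > 0"
  shows "(hankel_integral \<epsilon> \<rho> \<theta> 0 \<longlongrightarrow>
    2 * of_real pi * \<i> * (of_real \<rho> powr (\<theta> - 1) * exp (of_real \<rho>) * rGamma \<theta>)) at_top"
proof (cases "\<theta> \<in> \<int>")
  case True
  then obtain i where i: "\<theta> = of_int i" by (auto elim: Ints_cases)
  with \<theta> have "i > 0" by simp
  then obtain n where n: "i = int (Suc n)" by (metis gr0_conv_Suc zero_less_imp_eq_int)
  have "(hankel_integral \<epsilon> \<rho> 1 0 \<longlongrightarrow>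
      2 * of_real pi * \<i> * (of_real \<rho> powr (1 - 1) * exp (of_real \<rho>) * rGamma 1)) at_top"
    using hankel_integral_0_one[OF \<rho> \<epsilon>] \<rho> by simp
  moreover have "1 + complex_of_nat k \<noteq> 0" for k
    by (metis of_nat_Suc of_nat_neq_0)
  ultimately show ?thesis
    using hankel_integral_0_add_nat[OF \<rho> \<epsilon>, of 1 n] by (simp add: i n)
next
  case False
  obtain n where n: "Re \<theta> < real n" using reals_Archimedean2 by blast
  have "(hankel_integral \<epsilon> \<rho> (\<theta> - of_nat n) 0 \<longlongrightarrow>
    2 * of_real pi * \<i> * (of_real \<rho> powr (\<theta> - of_nat n - 1) * exp (of_real \<rho>) * rGamma (\<theta> - of_nat n))) at_top"
    by (rule hankel_integral_0_tendsto_Re_neg[OF \<rho> \<epsilon>]) (use n in simp)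
  moreover have "\<theta> - of_nat n + of_nat k \<noteq> 0" for k
  proof
    assume "\<theta> - of_nat n + of_nat k = 0"
    then have "\<theta> = of_nat n - of_nat k" by (simp add: algebra_simps)
    with False show False by simp
  qed
  ultimately show ?thesis
    using hankel_integral_0_add_nat[OF \<rho> \<epsilon>, of "\<theta> - of_nat n" n] by simp
qed

section \<open>The functions F and G\<close>

definition circle_coeff :: "real \<Rightarrow> real \<Rightarrow> complex \<Rightarrow> nat \<Rightarrow> complex" where
  "circle_coeff r \<rho> \<theta> k =
     contour_integral (circlepath 0 r) (\<lambda>z. exp (of_real \<rho> * z) / (z ^ k * (1 - z) powr \<theta>)) / (2 * of_real pi * \<i>)"

definition hankel_coeff :: "real \<Rightarrow> real \<Rightarrow> complex \<Rightarrow> nat \<Rightarrow> complex" where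
  "hankel_coeff \<epsilon> \<rho> \<theta> k = Lim at_top (hankel_integral \<epsilon> \<rho> \<theta> k) / (2 * of_real pi * \<i>)"

lemma erlang_F_eq_circle_coeff: "erlang_F r \<rho> (int n) \<theta> = circle_coeff r \<rho> \<theta> (Suc n)"
proof -
  have "int n + 1 = int (Suc n)" by simp
  then have "z powi (int n + 1) = z ^ Suc n" for z :: complex
    by (metis power_int_of_nat)
  then show ?thesis by (simp add: erlang_F_def circle_coeff_def)
qed

lemma erlang_G_eq_hankel_coeff: "erlang_G \<epsilon> \<rho> (int n) \<theta> = hankel_coeff \<epsilon> \<rho> \<theta> (Suc n)"
proof -
  have "int n + 1 = int (Suc n)" by simp
  then have "z powi (int n + 1) = z ^ Suc n" for z :: complex
    by (metis power_int_of_nat)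
  then show ?thesis by (simp add: erlang_G_def hankel_coeff_def hankel_integral_def[abs_def])
qed

lemma scaled_three_term_eq_0_D:
  fixes c x y z :: complex
  assumes "c * (x - y + z) = 0" "c \<noteq> 0"
  shows "z = y - x"
proof -
  have "x - y + z = 0" using assms by simp
  then show ?thesis by (simp add: algebra_simps eq_neg_iff_add_eq_0)
qed

lemma tendsto_hankel_integral:
  assumes "\<rho> > 0" "\<epsilon> > 0"
  shows "(hankel_integral \<epsilon> \<rho> \<theta> k \<longlongrightarrow> 2 * of_real pi * \<i> * hankel_coeff \<epsilon> \<rho> \<theta> k) at_top"
proof -
  obtain l where "(hankel_integral \<epsilon> \<rho> \<theta> k \<longlongrightarrow> l) at_top"
    using hankel_integral_converges[OF assms] by blast
  moreover from this have "Lim at_top (hankel_integral \<epsilon> \<rho> \<theta> k) = l"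
    by (intro tendsto_Lim) auto
  ultimately show ?thesis by (simp add: hankel_coeff_def)
qed

lemma hankel_coeff_recurrence:
  assumes "\<rho> > 0" "\<epsilon> > 0"
  shows "of_nat (Suc k) * hankel_coeff \<epsilon> \<rho> \<theta> (Suc (Suc k)) =
    (of_real \<rho> + \<theta> + of_nat k) * hankel_coeff \<epsilon> \<rho> \<theta> (Suc k) - of_real \<rho> * hankel_coeff \<epsilon> \<rho> \<theta> k"
proof -
  let ?b = "hankel_coeff \<epsilon> \<rho> \<theta>" and ?p = "2 * complex_of_real pi * \<i>"
  have "((\<lambda>R. of_real \<rho> * hankel_integral \<epsilon> \<rho> \<theta> k R
      - (of_real \<rho> + \<theta> + of_nat k) * hankel_integral \<epsilon> \<rho> \<theta> (Suc k) R
      + of_nat (Suc k) * hankel_integral \<epsilon> \<rho> \<theta> (Suc (Suc k)) R) \<longlongrightarrow>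
      of_real \<rho> * (?p * ?b k) - (of_real \<rho> + \<theta> + of_nat k) * (?p * ?b (Suc k))
      + of_nat (Suc k) * (?p * ?b (Suc (Suc k)))) at_top"
    by (intro tendsto_intros tendsto_hankel_integral assms)
  from tendsto_unique[OF _ this hankel_integral_recurrence[OF assms]]
  have "?p * (of_real \<rho> * ?b k - (of_real \<rho> + \<theta> + of_nat k) * ?b (Suc k)
      + of_nat (Suc k) * ?b (Suc (Suc k))) = 0"
    by (simp add: algebra_simps)
  then show ?thesis by (rule scaled_three_term_eq_0_D) simp
qed

lemma hankel_coeff_0:
  assumes "\<rho> > 0" "\<epsilon> > 0" "Re \<theta> > 0"
  shows "hankel_coeff \<epsilon> \<rho> \<theta> 0 = of_real \<rho> powr (\<theta> - 1) * exp (of_real \<rho>) * rGamma \<theta>"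
  using tendsto_unique[OF _ tendsto_hankel_integral[OF assms(1,2)] hankel_integral_0_tendsto[OF assms]]
  by simp

lemma has_field_derivative_powr_unit_disc:
  fixes z a :: complex
  assumes "norm z < 1"
  shows "((\<lambda>z. (1 - z) powr a) has_field_derivative - a * (1 - z) powr (a - 1)) (at z)"
proof -
  have "1 - z \<notin> \<real>\<^sub>\<le>\<^sub>0"
    using assms complex_Re_le_cmod[of z] by (auto simp: complex_nonpos_Reals_iff)
  moreover have "((\<lambda>z. 1 - z) has_field_derivative - 1) (at z)"
    by (auto intro!: derivative_eq_intros)
  ultimately show ?thesis
    using DERIV_chain2[of "\<lambda>z. z powr a" _ "\<lambda>z. 1 - z" z "- 1" UNIV] has_field_derivative_powr by fastforce
qed

lemma holomorphic_on_circle_integrand: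
  "(\<lambda>z. exp (of_real \<rho> * z) / (1 - z) powr \<theta>) holomorphic_on ball 0 1"
proof -
  have "(\<lambda>z. (1 - z) powr \<theta>) holomorphic_on ball 0 1"
    by (auto simp: holomorphic_on_open intro!: exI has_field_derivative_powr_unit_disc)
  then show ?thesis
    by (rule holomorphic_on_divide[rotated]) (auto intro!: holomorphic_intros)
qed

context
  fixes r \<rho> :: real
  assumes r: "0 < r" "r < 1"
begin

text \<open>At index -1 the integrand has no pole inside the circle. This is the boundary condition
  at state 0.\<close>

lemma circle_coeff_0: "circle_coeff r \<rho> \<theta> 0 = 0"
proof -
  have "((\<lambda>z. exp (of_real \<rho> * z) / (1 - z) powr \<theta>) has_contour_integral 0) (circlepath 0 r)"
    by (rule Cauchy_theorem_disc_simple[OF holomorphic_on_circle_integrand]) (use r in auto)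
  then show ?thesis by (simp add: circle_coeff_def contour_integral_unique)
qed

lemma circle_coeff_1: "circle_coeff r \<rho> \<theta> (Suc 0) = 1"
proof -
  have "(\<lambda>z. exp (of_real \<rho> * z) / (1 - z) powr \<theta>) holomorphic_on cball 0 r"
    by (rule holomorphic_on_subset[OF holomorphic_on_circle_integrand]) (use r in auto)
  from Cauchy_integral_circlepath_simple[OF this, of 0] r
  have "((\<lambda>z. exp (of_real \<rho> * z) / (z * (1 - z) powr \<theta>)) has_contour_integral 2 * of_real pi * \<i>) (circlepath 0 r)"
    by (simp add: mult.commute)
  then show ?thesis by (simp add: circle_coeff_def contour_integral_unique)
qed

text \<open>Same total derivative as on the Hankel contour, with \<open>1 - z\<close> for
  \<open>z - 1\<close> and hence the opposite sign. \<open>A\<close> is single-valued on the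
  punctured disc, so its derivative integrates to zero around the closed circle although the circle
  surrounds the pole.\<close>

lemma circle_coeff_recurrence:
  "of_nat (Suc k) * circle_coeff r \<rho> \<theta> (Suc (Suc k)) =
    (of_real \<rho> + \<theta> + of_nat k) * circle_coeff r \<rho> \<theta> (Suc k) - of_real \<rho> * circle_coeff r \<rho> \<theta> k"
proof -
  define \<phi> where "\<phi> k z = exp (of_real \<rho> * z) / (z ^ k * (1 - z) powr \<theta>)" for k z
  define A where "A z = exp (of_real \<rho> * z) * (1 - z) powr (1 - \<theta>) / z ^ Suc k" for z
  define S where "S = ball (0::complex) 1 - {0}"
  have circ: "path_image (circlepath 0 r) \<subseteq> S" using r by (auto simp: S_def)
  have deriv: "(A has_field_derivative - (of_real \<rho> * \<phi> k z - (of_real \<rho> + \<theta> + of_nat k) * \<phi> (Suc k) z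
      + of_nat (Suc k) * \<phi> (Suc (Suc k)) z)) (at z within S)" if "z \<in> S" for z
  proof -
    have nz: "z \<noteq> 0" "1 - z \<noteq> 0" "norm z < 1" using that by (auto simp: S_def)
    define P where "P = (1 - z) powr (- \<theta>)"
    have P: "(1 - z) powr (1 - \<theta>) = (1 - z) * P" "1 / (1 - z) powr \<theta> = P"
      using nz powr_add[of "1 - z" 1 "- \<theta>"] by (simp_all add: P_def powr_minus divide_inverse)
    have \<phi>: "\<phi> l z = exp (of_real \<rho> * z) * P / z ^ l" for l
      by (simp add: \<phi>_def P(2)[symmetric])
    have powr': "((\<lambda>z. (1 - z) powr (1 - \<theta>)) has_field_derivative - (1 - \<theta>) * P) (at z)"
      using has_field_derivative_powr_unit_disc[OF nz(3), of "1 - \<theta>"] by (simp add: P_def)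
    have e': "((\<lambda>z. exp (of_real \<rho> * z)) has_field_derivative of_real \<rho> * exp (of_real \<rho> * z)) (at z)"
      by (auto intro!: derivative_eq_intros)
    have pow': "((\<lambda>z. z ^ Suc k) has_field_derivative of_nat (Suc k) * z ^ k) (at z)"
      by (rule derivative_eq_intros refl | simp)+
    have "(A has_field_derivative
       ((of_real \<rho> * exp (of_real \<rho> * z) * (1 - z) powr (1 - \<theta>) + - (1 - \<theta>) * P * exp (of_real \<rho> * z)) * z ^ Suc k
        - exp (of_real \<rho> * z) * (1 - z) powr (1 - \<theta>) * (of_nat (Suc k) * z ^ k)) / (z ^ Suc k * z ^ Suc k)) (at z)"
      unfolding A_def
      by (rule DERIV_divide[OF DERIV_mult[OF e' powr'] pow']) (use nz in simp)
    also have "((of_real \<rho> * exp (of_real \<rho> * z) * (1 - z) powr (1 - \<theta>) + - (1 - \<theta>) * P * exp (of_real \<rho> * z)) * z ^ Suc k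
        - exp (of_real \<rho> * z) * (1 - z) powr (1 - \<theta>) * (of_nat (Suc k) * z ^ k)) / (z ^ Suc k * z ^ Suc k)
      = - (of_real \<rho> * \<phi> k z - (of_real \<rho> + \<theta> + of_nat k) * \<phi> (Suc k) z
      + of_nat (Suc k) * \<phi> (Suc (Suc k)) z)"
      unfolding \<phi> P(1) using nz by (simp add: divide_simps) (simp add: algebra_simps)
    finally show ?thesis by (rule has_field_derivative_at_within)
  qed
  have int: "\<phi> l contour_integrable_on (circlepath 0 r)" for l
  proof (rule contour_integrable_continuous_circlepath, rule holomorphic_on_imp_continuous_on,
      rule holomorphic_on_subset[OF _ circ])
    have "(\<lambda>z. (exp (of_real \<rho> * z) / (1 - z) powr \<theta>) / z ^ l) holomorphic_on S"
      unfolding S_def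
      by (intro holomorphic_on_divide holomorphic_on_subset[OF holomorphic_on_circle_integrand]
          holomorphic_intros) auto
    then show "\<phi> l holomorphic_on S" by (simp add: \<phi>_def[abs_def] mult.commute)
  qed
  have "((\<lambda>z. - (of_real \<rho> * \<phi> k z - (of_real \<rho> + \<theta> + of_nat k) * \<phi> (Suc k) z
      + of_nat (Suc k) * \<phi> (Suc (Suc k)) z)) has_contour_integral 0) (circlepath 0 r)"
    using contour_integral_primitive[OF deriv valid_path_circlepath circ] by simp
  from has_contour_integral_unique[OF this has_contour_integral_neg[OF has_contour_integral_linear3[OF int int int]]]
  have eq: "of_real \<rho> * contour_integral (circlepath 0 r) (\<phi> k)
      - (of_real \<rho> + \<theta> + of_nat k) * contour_integral (circlepath 0 r) (\<phi> (Suc k))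
      + of_nat (Suc k) * contour_integral (circlepath 0 r) (\<phi> (Suc (Suc k))) = 0"
    by (metis neg_equal_0_iff_equal)
  have "contour_integral (circlepath 0 r) (\<phi> l) = 2 * of_real pi * \<i> * circle_coeff r \<rho> \<theta> l" for l
    by (simp add: circle_coeff_def \<phi>_def[abs_def])
  from eq[unfolded this]
  have "2 * of_real pi * \<i> * (of_real \<rho> * circle_coeff r \<rho> \<theta> k
      - (of_real \<rho> + \<theta> + of_nat k) * circle_coeff r \<rho> \<theta> (Suc k)
      + of_nat (Suc k) * circle_coeff r \<rho> \<theta> (Suc (Suc k))) = 0"
    by (simp add: algebra_simps)
  then show ?thesis by (rule scaled_three_term_eq_0_D) simp
qed

end

section \<open>Casoratian, normalisation and the limit formulas\<close>

text \<open>Discrete Abel identity: the middle coefficients cancel by antisymmetry, leaving a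
  first-order recurrence whose factors multiply up to \<open>\<rho>^k / k!\<close>.\<close>

lemma casoratian_recurrence:
  fixes a b :: "nat \<Rightarrow> complex" and \<rho> :: real
  assumes a: "\<And>k. of_nat (Suc k) * a (Suc (Suc k)) = (of_real \<rho> + \<theta> + of_nat k) * a (Suc k) - of_real \<rho> * a k"
    and b: "\<And>k. of_nat (Suc k) * b (Suc (Suc k)) = (of_real \<rho> + \<theta> + of_nat k) * b (Suc k) - of_real \<rho> * b k"
  shows "fact k * (a (Suc k) * b k - a k * b (Suc k)) = of_real \<rho> ^ k * (a 1 * b 0 - a 0 * b 1)"
proof (induction k)
  case (Suc k)
  have "fact (Suc k) * (a (Suc (Suc k)) * b (Suc k) - a (Suc k) * b (Suc (Suc k)))
      = fact k * ((of_nat (Suc k) * a (Suc (Suc k))) * b (Suc k) - a (Suc k) * (of_nat (Suc k) * b (Suc (Suc k))))"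
    by (simp add: algebra_simps)
  also have "\<dots> = of_real \<rho> * (fact k * (a (Suc k) * b k - a k * b (Suc k)))"
    unfolding a b by (simp add: algebra_simps)
  finally show ?case unfolding Suc.IH by simp
qed simp

text \<open>Passage from the forward to the backward recurrence by dividing by the reversing measure
  \<open>\<rho>^i / i!\<close>. At \<open>i = 0\<close> the backward equation has no predecessor
  term, so \<open>a 0\<close> must vanish there: the circle coefficients meet this condition, the
  Hankel coefficients are used only for \<open>i > 0\<close>.\<close>

lemma scaled_recurrence:
  fixes a :: "nat \<Rightarrow> complex" and \<rho> :: real
  assumes \<rho>: "\<rho> \<noteq> 0"
    and a: "\<And>k. of_nat (Suc k) * a (Suc (Suc k)) = (of_real \<rho> + \<theta> + of_nat k) * a (Suc k) - of_real \<rho> * a k"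
    and i: "i > 0 \<or> a 0 = 0"
  defines "u \<equiv> \<lambda>i. fact i / of_real \<rho> ^ i * a (Suc i)"
  shows "of_real \<rho> * u (Suc i) = (\<theta> + of_real \<rho> + of_nat i) * u i - of_nat i * u (i - 1)"
proof -
  have "of_real \<rho> * u (Suc i) = fact i / of_real \<rho> ^ i * (of_nat (Suc i) * a (Suc (Suc i)))"
    using \<rho> by (simp add: u_def)
  also have "\<dots> = (\<theta> + of_real \<rho> + of_nat i) * u i - fact i / of_real \<rho> ^ i * of_real \<rho> * a i"
    unfolding a using \<rho> by (simp add: u_def field_simps)
  also have "fact i / of_real \<rho> ^ i * of_real \<rho> * a i = of_nat i * u (i - 1)"
    using \<rho> i by (cases i) (auto simp: u_def)
  finally show ?thesis .
qed

text \<open>Explains the prefactor of the result: up to the factor \<rho>,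
  \<open>Gamma \<theta> * exp (- \<rho>) / \<rho> powr \<theta>\<close> is the reciprocal of the
  Casoratian at index -1.\<close>

lemma hankel_coeff_0_times_Gamma:
  assumes "\<rho> > 0" "\<epsilon> > 0" "Re \<theta> > 0"
  shows "Gamma \<theta> * exp (- of_real \<rho>) / of_real \<rho> powr \<theta> * hankel_coeff \<epsilon> \<rho> \<theta> 0 = 1 / of_real \<rho>"
proof -
  have "\<theta> \<notin> \<int>\<^sub>\<le>\<^sub>0" using assms(3) by (auto elim!: nonpos_Ints_cases')
  then have "Gamma \<theta> * rGamma \<theta> = 1" by (simp add: Gamma_def rGamma_eq_zero_iff)
  moreover have "complex_of_real \<rho> powr (\<theta> - 1) = of_real \<rho> powr \<theta> / of_real \<rho>"
    using assms(1) by (simp add: powr_diff)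
  moreover have "exp (- complex_of_real \<rho>) * exp (of_real \<rho>) = 1"
    by (simp add: exp_add[symmetric])
  moreover have "Gamma \<theta> * exp (- of_real \<rho>) / of_real \<rho> powr \<theta> * hankel_coeff \<epsilon> \<rho> \<theta> 0
      = (Gamma \<theta> * rGamma \<theta>) * (exp (- of_real \<rho>) * exp (of_real \<rho>)) *
        (of_real \<rho> powr (\<theta> - 1) / of_real \<rho> powr \<theta>)"
    by (simp add: hankel_coeff_0[OF assms] mult_ac)
  ultimately show ?thesis using assms(1) by simp
qed

lemma erlang_casoratian:
  fixes \<theta> :: complex
  assumes "\<rho> > 0" "\<epsilon> > 0" "0 < r" "r < 1"
  shows "fact k * (circle_coeff r \<rho> \<theta> (Suc k) * hankel_coeff \<epsilon> \<rho> \<theta> k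
      - circle_coeff r \<rho> \<theta> k * hankel_coeff \<epsilon> \<rho> \<theta> (Suc k)) =
    of_real \<rho> ^ k * hankel_coeff \<epsilon> \<rho> \<theta> 0"
  using casoratian_recurrence[OF circle_coeff_recurrence[OF assms(3,4)] hankel_coeff_recurrence[OF assms(1,2)], of k]
    circle_coeff_0[OF assms(3,4)] circle_coeff_1[OF assms(3,4)] by simp

theorem corollary4:
  fixes m n\<^sub>0 :: nat and \<rho> r \<epsilon> :: real and \<theta> :: complex
    and M :: "real \<Rightarrow> 'a measure" and N :: "real \<Rightarrow> real \<Rightarrow> 'a \<Rightarrow> nat"
    and p :: "real \<Rightarrow> nat \<Rightarrow> real \<Rightarrow> real"
  assumes "m \<ge> 1" and "n\<^sub>0 \<le> m" and "\<rho> > 0" and "Re \<theta> > 0"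
    and "0 < r" and "r < 1" and "\<epsilon> > 0"
    and "\<And>\<eta>. \<eta> > 0 \<Longrightarrow> erlang_A_process m \<rho> \<eta> n\<^sub>0 (M \<eta>) (N \<eta>)"
    and "\<And>\<eta> n t. \<eta> > 0 \<Longrightarrow> t \<ge> 0 \<Longrightarrow>
           p \<eta> n t = \<P>(x in M \<eta>. N \<eta> t x = n \<bar> N \<eta> 0 x = n\<^sub>0)"
  shows "(\<forall>n. n\<^sub>0 \<le> n \<and> n \<le> m \<longrightarrow>
            ((\<lambda>\<eta>. laplace_transform (p \<eta> n) \<theta>) \<longlongrightarrow>
               fact n\<^sub>0 * Gamma \<theta> * exp (- of_real \<rho>) / of_real \<rho> powr (of_nat n\<^sub>0 + \<theta>) *
               erlang_F r \<rho> (int n\<^sub>0) \<theta> *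
               (erlang_G \<epsilon> \<rho> (int n) \<theta> + erlang_omega r \<epsilon> \<rho> m \<theta> * erlang_F r \<rho> (int n) \<theta>)) at_top)
       \<and> (\<forall>n\<le>n\<^sub>0.
            ((\<lambda>\<eta>. laplace_transform (p \<eta> n) \<theta>) \<longlongrightarrow>
               fact n\<^sub>0 * Gamma \<theta> * exp (- of_real \<rho>) / of_real \<rho> powr (of_nat n\<^sub>0 + \<theta>) *
               erlang_F r \<rho> (int n) \<theta> *
               (erlang_G \<epsilon> \<rho> (int n\<^sub>0) \<theta> + erlang_omega r \<epsilon> \<rho> m \<theta> * erlang_F r \<rho> (int n\<^sub>0) \<theta>)) at_top)
       \<and> ((\<lambda>\<eta>. laplace_transform (p \<eta> m) \<theta>) \<longlongrightarrow>
               fact n\<^sub>0 / fact m * of_real \<rho> ^ (m - n\<^sub>0) *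
               (erlang_F r \<rho> (int n\<^sub>0) \<theta> /
                (of_nat (m + 1) * erlang_F r \<rho> (int m + 1) \<theta>
                   - of_real \<rho> * erlang_F r \<rho> (int m) \<theta>))) at_top"
proof -
  define a where "a = circle_coeff r \<rho> \<theta>"
  define b where "b = hankel_coeff \<epsilon> \<rho> \<theta>"
  define u where "u i = fact i / of_real \<rho> ^ i * a (Suc i)" for i
  define v where "v i = fact i / of_real \<rho> ^ i * b (Suc i)" for i
  define \<omega> where "\<omega> = erlang_omega r \<epsilon> \<rho> m \<theta>"
  define C where "C = Gamma \<theta> * exp (- of_real \<rho>) / of_real \<rho> powr \<theta>"
  \<comment> \<open>The scaling built into \<open>u\<close> and \<open>v\<close> is undone at the
    target state by its weight \<open>\<rho>^j / j!\<close>; the rest is the constant that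
    normalises the Casoratian.\<close>
  define \<kappa> where "\<kappa> j = of_real \<rho> ^ j / fact j * C" for j
  note \<rho> = \<open>\<rho> > 0\<close> and \<theta> = \<open>Re \<theta> > 0\<close> and \<epsilon> = \<open>\<epsilon> > 0\<close> and r = \<open>0 < r\<close> \<open>r < 1\<close>
  have \<rho>0: "complex_of_real \<rho> \<noteq> 0" using \<rho> by simp
  have F: "erlang_F r \<rho> (int n) \<theta> = a (Suc n)" and G: "erlang_G \<epsilon> \<rho> (int n) \<theta> = b (Suc n)" for n
    by (simp_all add: a_def b_def erlang_F_eq_circle_coeff erlang_G_eq_hankel_coeff)
  have F': "erlang_F r \<rho> (int m + 1) \<theta> = a (Suc (Suc m))" and G': "erlang_G \<epsilon> \<rho> (int m + 1) \<theta> = b (Suc (Suc m))"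
    using F[of "Suc m"] G[of "Suc m"] by (simp_all add: add.commute)
  have a0: "a 0 = 0" and a1: "a (Suc 0) = 1"
    by (simp_all add: a_def circle_coeff_0[OF r] circle_coeff_1[OF r])
  have a_rec: "of_nat (Suc k) * a (Suc (Suc k)) = (of_real \<rho> + \<theta> + of_nat k) * a (Suc k) - of_real \<rho> * a k" for k
    unfolding a_def by (rule circle_coeff_recurrence[OF r])
  have b_rec: "of_nat (Suc k) * b (Suc (Suc k)) = (of_real \<rho> + \<theta> + of_nat k) * b (Suc k) - of_real \<rho> * b k" for k
    unfolding b_def by (rule hankel_coeff_recurrence[OF \<rho> \<epsilon>])
  have u0: "u 0 = 1" by (simp add: u_def a1)
  have u_rec: "of_real \<rho> * u (Suc i) = (\<theta> + of_real \<rho> + of_nat i) * u i - of_nat i * u (i - 1)" for i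
    unfolding u_def by (rule scaled_recurrence[OF _ a_rec]) (use \<rho> a0 in auto)
  have v_rec: "of_real \<rho> * v (Suc i) = (\<theta> + of_real \<rho> + of_nat i) * v i - of_nat i * v (i - 1)" if "i > 0" for i
    unfolding v_def by (rule scaled_recurrence[OF _ b_rec]) (use \<rho> that in auto)
  have cas: "fact k * (a (Suc k) * b k - a k * b (Suc k)) = of_real \<rho> ^ k * b 0" for k
    unfolding a_def b_def by (rule erlang_casoratian[OF \<rho> \<epsilon> r])
  have C: "C * b 0 = 1 / of_real \<rho>"
    unfolding C_def b_def by (rule hankel_coeff_0_times_Gamma[OF \<rho> \<epsilon> \<theta>])
  have \<kappa>: "\<kappa> j * (u (Suc j) * v j - u j * v (Suc j)) = 1 / of_real \<rho>" for j
  proof -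
    have "\<kappa> j * (u (Suc j) * v j - u j * v (Suc j)) = C / of_real \<rho> ^ Suc j *
        (fact (Suc j) * (a (Suc (Suc j)) * b (Suc j) - a (Suc j) * b (Suc (Suc j))))"
      using \<rho>0 by (simp add: \<kappa>_def u_def v_def field_simps)
    also have "\<dots> = C * b 0" unfolding cas using \<rho>0 by simp
    finally show ?thesis by (simp only: C)
  qed
  have diff_u: "u (Suc m) - u m = fact m / of_real \<rho> ^ Suc m * (of_nat (m + 1) * a (Suc (Suc m)) - of_real \<rho> * a (Suc m))"
    and diff_v: "v (Suc m) - v m = fact m / of_real \<rho> ^ Suc m * (of_nat (m + 1) * b (Suc (Suc m)) - of_real \<rho> * b (Suc m))"
    using \<rho>0 by (simp_all add: u_def v_def field_simps)
  define D where "D = of_nat (m + 1) * a (Suc (Suc m)) - of_real \<rho> * a (Suc m)"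
  \<comment> \<open>\<open>D\<close> is the negative of the denominator of \<omega>, hence the sign;
    it is the denominator of the blocking formula.\<close>
  have \<omega>_D: "\<omega> = - ((of_nat (m + 1) * b (Suc (Suc m)) - of_real \<rho> * b (Suc m)) / D)"
    unfolding \<omega>_def erlang_omega_def F G F' G' D_def
    by (metis minus_diff_eq minus_divide_right)
  have \<omega>: "\<omega> = - ((v (Suc m) - v m) / (u (Suc m) - u m))"
    unfolding diff_u diff_v \<omega>_D D_def[symmetric] using \<rho>0 by simp
  have "u (Suc m) - u m \<noteq> 0"
    using norm_increasing_recurrence[OF \<rho> \<theta> _ u_rec, of m] u0 by auto
  then have D: "D \<noteq> 0" unfolding diff_u D_def by auto
  \<comment> \<open>Each \<eta> has its own transition function. Guarding by
    \<open>\<eta> > 0\<close> makes the claim total, so that one family can be chosen.\<close>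
  have "\<forall>\<eta>. \<exists>P. \<eta> > 0 \<longrightarrow> transition_function P \<and>
      (\<forall>i j. (P i j has_real_derivative birth_death_rate (\<lambda>_. \<rho>) (erlang_A_death m \<eta>) i j) (at_right 0)) \<and>
      (\<forall>n t. t \<ge> 0 \<longrightarrow> p \<eta> n t = P n\<^sub>0 n t)"
  proof
    fix \<eta> :: real
    show "\<exists>P. \<eta> > 0 \<longrightarrow> transition_function P \<and>
      (\<forall>i j. (P i j has_real_derivative birth_death_rate (\<lambda>_. \<rho>) (erlang_A_death m \<eta>) i j) (at_right 0)) \<and>
      (\<forall>n t. t \<ge> 0 \<longrightarrow> p \<eta> n t = P n\<^sub>0 n t)"
    proof (cases "\<eta> > 0")
      case True
      obtain Q where "transition_function Q"
        and "\<And>i j. (Q i j has_real_derivative birth_death_rate (\<lambda>_. \<rho>) (erlang_A_death m \<eta>) i j) (at_right 0)"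
        and "\<And>n t. t \<ge> 0 \<Longrightarrow> \<P>(x in M \<eta>. N \<eta> t x = n \<bar> N \<eta> 0 x = n\<^sub>0) = Q n\<^sub>0 n t"
        using erlang_A_process_transition_function[OF assms(8)[OF True]] by blast
      then show ?thesis by (intro exI[of _ Q]) (simp add: assms(9)[OF True])
    qed simp
  qed
  from choice[OF this] obtain P where "\<forall>\<eta>. \<eta> > 0 \<longrightarrow> transition_function (P \<eta>) \<and>
      (\<forall>i j. (P \<eta> i j has_real_derivative birth_death_rate (\<lambda>_. \<rho>) (erlang_A_death m \<eta>) i j) (at_right 0)) \<and>
      (\<forall>n t. t \<ge> 0 \<longrightarrow> p \<eta> n t = P \<eta> n\<^sub>0 n t)" by blast
  then have P: "\<And>\<eta>. \<eta> > 0 \<Longrightarrow> transition_function (P \<eta>)"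
    and deriv: "\<And>\<eta> i j. \<eta> > 0 \<Longrightarrow> (P \<eta> i j has_real_derivative
        birth_death_rate (\<lambda>_. \<rho>) (erlang_A_death m \<eta>) i j) (at_right 0)"
    and pP: "\<And>\<eta> n t. \<eta> > 0 \<Longrightarrow> t \<ge> 0 \<Longrightarrow> p \<eta> n t = P \<eta> n\<^sub>0 n t"
    by blast+
  have limit: "((\<lambda>\<eta>. laplace_transform (p \<eta> n) \<theta>) \<longlongrightarrow>
      (if n\<^sub>0 \<le> n then \<kappa> n * u n\<^sub>0 * (v n + \<omega> * u n) else \<kappa> n * u n * (v n\<^sub>0 + \<omega> * u n\<^sub>0))) at_top"
    if n: "n \<le> m" for n
  proof -
    \<comment> \<open>The target \<open>n\<close> is fixed and the starting state varies; the wanted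
      transform is the component at \<open>n\<^sub>0\<close>.\<close>
    define L where "L \<eta> i = laplace_transform (P \<eta> i n) \<theta>" for \<eta> i
    have L_bound: "norm (L \<eta> i) \<le> 1 / Re \<theta>" if "\<eta> > 0" for \<eta> i
      unfolding L_def by (rule laplace_transform_transition_bound[OF P[OF that] deriv[OF that] \<theta>])
    note eqn = erlang_A_resolvent_equation[OF P deriv \<theta>, where j = n, folded L_def]
    have L_rec: "of_real \<rho> * L \<eta> (Suc i) =
        (\<theta> + of_real \<rho> + of_nat i) * L \<eta> i - of_nat i * L \<eta> (i - 1) - (if i = n then 1 else 0)"
      if "\<eta> > 0" "i \<le> m" for \<eta> i
      using eqn[OF that(1) that(1), of i] that(2) by (simp add: erlang_A_death_def)
    have L_top: "of_real \<rho> * L \<eta> (Suc (Suc m)) =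
        (\<theta> + of_real \<rho> + of_real (real m + \<eta>)) * L \<eta> (Suc m) - of_real (real m + \<eta>) * L \<eta> m"
      if "\<eta> > 0" for \<eta>
      using eqn[OF that that, of "Suc m"] n by (simp add: erlang_A_death_def)
    have "((\<lambda>\<eta>. L \<eta> n\<^sub>0) \<longlongrightarrow>
      (if n\<^sub>0 \<le> n then \<kappa> n * u n\<^sub>0 * (v n + \<omega> * u n) else \<kappa> n * u n * (v n\<^sub>0 + \<omega> * u n\<^sub>0))) at_top"
      by (rule reflected_system_limit[OF \<rho> \<theta> u0 n \<open>n\<^sub>0 \<le> m\<close> u_rec v_rec \<kappa> L_rec
            erlang_A_reflection_limit[OF L_top L_bound] \<omega>])
    moreover have "\<forall>\<^sub>F \<eta> in at_top. L \<eta> n\<^sub>0 = laplace_transform (p \<eta> n) \<theta>"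
      using eventually_gt_at_top[of 0]
    proof eventually_elim
      case (elim \<eta>)
      show ?case unfolding L_def laplace_transform_def
        by (intro set_lebesgue_integral_cong) (auto simp: pP[OF elim])
    qed
    ultimately show ?thesis by (rule Lim_transform_eventually)
  qed
  have powr: "of_real \<rho> powr (of_nat n\<^sub>0 + \<theta>) = of_real \<rho> ^ n\<^sub>0 * of_real \<rho> powr \<theta>"
    using \<rho>0 by (simp add: powr_add)
  define K where "K = fact n\<^sub>0 * Gamma \<theta> * exp (- of_real \<rho>) / of_real \<rho> powr (of_nat n\<^sub>0 + \<theta>)"
  have K: "K = fact n\<^sub>0 / of_real \<rho> ^ n\<^sub>0 * C"
    by (simp add: K_def C_def powr)
  have up: "\<kappa> n * u n\<^sub>0 * (v n + \<omega> * u n) = K * a (Suc n\<^sub>0) * (b (Suc n) + \<omega> * a (Suc n))"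
    and down: "\<kappa> n * u n * (v n\<^sub>0 + \<omega> * u n\<^sub>0) = K * a (Suc n) * (b (Suc n\<^sub>0) + \<omega> * a (Suc n\<^sub>0))" for n
    using \<rho>0 by (simp_all add: K \<kappa>_def u_def v_def field_simps)
  have up_lim: "((\<lambda>\<eta>. laplace_transform (p \<eta> n) \<theta>) \<longlongrightarrow>
      K * a (Suc n\<^sub>0) * (b (Suc n) + \<omega> * a (Suc n))) at_top" if "n\<^sub>0 \<le> n" "n \<le> m" for n
    using limit[OF that(2)] that(1) by (simp add: up)
  have down_lim: "((\<lambda>\<eta>. laplace_transform (p \<eta> n) \<theta>) \<longlongrightarrow>
      K * a (Suc n) * (b (Suc n\<^sub>0) + \<omega> * a (Suc n\<^sub>0))) at_top" if "n \<le> n\<^sub>0" for n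
  proof (cases "n = n\<^sub>0")
    case True
    then show ?thesis using up_lim[of n] \<open>n\<^sub>0 \<le> m\<close> by simp
  next
    case False
    then show ?thesis using limit[of n] that \<open>n\<^sub>0 \<le> m\<close> by (simp add: down)
  qed
  \<comment> \<open>At \<open>n = m\<close> the bracket, brought over the denominator
    \<open>D\<close>, has \<open>Suc m\<close> times the Casoratian at \<open>Suc m\<close> as its
    numerator. Its known value cancels the Gamma factor, the exponential and all of
    \<open>G\<close>.\<close>
  have block: "K * a (Suc n\<^sub>0) * (b (Suc m) + \<omega> * a (Suc m)) =
      fact n\<^sub>0 / fact m * of_real \<rho> ^ (m - n\<^sub>0) * (a (Suc n\<^sub>0) / D)"
  proof -
    have "b (Suc m) + \<omega> * a (Suc m) = (D * b (Suc m)
        - (of_nat (m + 1) * b (Suc (Suc m)) - of_real \<rho> * b (Suc m)) * a (Suc m)) / D"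
      using D by (simp add: \<omega>_D field_simps)
    also have "D * b (Suc m) - (of_nat (m + 1) * b (Suc (Suc m)) - of_real \<rho> * b (Suc m)) * a (Suc m)
      = of_nat (Suc m) * (a (Suc (Suc m)) * b (Suc m) - a (Suc m) * b (Suc (Suc m)))"
      by (simp add: D_def algebra_simps)
    also have "\<dots> = of_real \<rho> ^ Suc m * b 0 / fact m"
      using cas[of "Suc m"] by (simp add: field_simps)
    finally have "K * a (Suc n\<^sub>0) * (b (Suc m) + \<omega> * a (Suc m))
        = fact n\<^sub>0 / fact m * (of_real \<rho> ^ Suc m / of_real \<rho> ^ n\<^sub>0) * (C * b 0) * (a (Suc n\<^sub>0) / D)"
      by (simp add: K mult_ac)
    also have "of_real \<rho> ^ Suc m / of_real \<rho> ^ n\<^sub>0 = of_real \<rho> * complex_of_real \<rho> ^ (m - n\<^sub>0)"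
      using \<rho>0 \<open>n\<^sub>0 \<le> m\<close> by (simp add: power_diff)
    finally show ?thesis using \<rho>0 by (simp add: C)
  qed
  show ?thesis
    unfolding F G F' G' K_def[symmetric] \<omega>_def[symmetric] D_def[symmetric] block[symmetric]
    using up_lim down_lim \<open>n\<^sub>0 \<le> m\<close> by blast
qed

end
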